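(* Let the coefficients $g_{r,s,t}(n)$ and $h_{r,s,t}(n)$ be defined by \begin{align*} (-q^{r},-q^{t-r};q^{t})_{\infty}^{3}(q^{s},q^{2t-s};q^{2t})_{\infty} &=\sum_{n=0}^{\infty}g_{r,s,t}(n)q^{n},\\ (-q^{r},-q^{t-r};q^{t})_{\infty}(q^{s},q^{2t-s};q^{2t})_{\infty}^{3} &=\sum_{n=0}^{\infty}h_{r,s,t}(n)q^{n}. \end{align*} Then for any integer $n\geq0$, \begin{align*} g_{1,2,5}(5n+1) &=g_{2,4,5}(5n+2),\\ g_{1,2,5}(5n+3) &=-g_{2,4,5}(5n+4),\\ g_{1,3,5}(5n) &=g_{2,1,5}(5n),\\ g_{1,3,5}(5n+2) &=g_{2,1,5}(5n+2),\\ h_{1,1,5}(5n) &=h_{2,3,5}(5n+2),\\ h_{1,1,5}(5n+1) &=h_{2,3,5}(5n+3),\\ h_{1,4,5}(5n+1) &=h_{2,2,5}(5n),\\ h_{1,4,5}(5n+2) &=-h_{2,2,5}(5n+1). \end{align*}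
   Context: Notation: for $|q|<1$, $(a;q)_{\infty}:=\prod_{n=0}^{\infty}(1-aq^{n})$ and $(a_{1},\ldots,a_{m};q)_{\infty}:=(a_{1};q)_{\infty}\cdots(a_{m};q)_{\infty}$; similarly with $q$ replaced by $q^k$ in the base. In the definitions of $g_{r,s,t}$ and $h_{r,s,t}$, $t\ge5$ is a prime and $r,s$ are positive integers with $r<t$, $s\ne t$; only $t=5$ and the listed pairs $(r,s)$ occur in the claim. *)

theory Defs
  imports "HOL-Complex_Analysis.Complex_Analysis"
begin

definition qpoch :: "complex \<Rightarrow> complex \<Rightarrow> complex" where
  "qpoch a q = (\<Prod>n. 1 - a * q ^ n)"

definition power_series_on_unit_disc :: "(nat \<Rightarrow> complex) \<Rightarrow> (complex \<Rightarrow> complex) \<Rightarrow> bool" where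
  "power_series_on_unit_disc c f \<longleftrightarrow> (\<forall>q. norm q < 1 \<longrightarrow> (\<lambda>n. c n * q ^ n) sums f q)"

text \<open>
  The exponents are natural numbers. The subtraction in \<open>2 * t - s\<close> is thus truncated for
  \<open>s > 2 * t\<close>, where the product would involve negative powers of \<open>q\<close> and have no
  expansion in powers \<open>q ^ n\<close>, \<open>n \<ge> 0\<close>.
\<close>

definition g_prod :: "nat \<Rightarrow> nat \<Rightarrow> nat \<Rightarrow> complex \<Rightarrow> complex" where
  "g_prod r s t q =
     (qpoch (- (q ^ r)) (q ^ t) * qpoch (- (q ^ (t - r))) (q ^ t)) ^ 3 *
     (qpoch (q ^ s) (q ^ (2 * t)) * qpoch (q ^ (2 * t - s)) (q ^ (2 * t)))"

definition h_prod :: "nat \<Rightarrow> nat \<Rightarrow> nat \<Rightarrow> complex \<Rightarrow> complex" where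
  "h_prod r s t q =
     (qpoch (- (q ^ r)) (q ^ t) * qpoch (- (q ^ (t - r))) (q ^ t)) *
     (qpoch (q ^ s) (q ^ (2 * t)) * qpoch (q ^ (2 * t - s)) (q ^ (2 * t))) ^ 3"

definition g_coeff :: "nat \<Rightarrow> nat \<Rightarrow> nat \<Rightarrow> nat \<Rightarrow> complex" where
  "g_coeff r s t = (THE c. power_series_on_unit_disc c (g_prod r s t))"

definition h_coeff :: "nat \<Rightarrow> nat \<Rightarrow> nat \<Rightarrow> nat \<Rightarrow> complex" where
  "h_coeff r s t = (THE c. power_series_on_unit_disc c (h_prod r s t))"

text \<open>Both definite descriptions are well-defined for all \<open>t > 0\<close>.\<close>

lemma qpoch_factors_tendsto:
  assumes "norm q < 1"
  shows "(\<lambda>N. \<Prod>n<N. 1 - a * q ^ n) \<longlonglongrightarrow> qpoch a q"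
proof -
  have "summable (\<lambda>n. norm a * norm q ^ n)"
    using assms by (intro summable_mult summable_geometric) auto
  then have "summable (\<lambda>n. norm ((1 - a * q ^ n) - 1))"
    by (simp add: norm_mult norm_power)
  then have "abs_convergent_prod (\<lambda>n. 1 - a * q ^ n)"
    by (simp add: abs_convergent_prod_conv_summable)
  then have "convergent_prod (\<lambda>n. 1 - a * q ^ n)"
    by (rule abs_convergent_prod_imp_convergent_prod)
  then have "(\<lambda>n. 1 - a * q ^ n) has_prod qpoch a q"
    unfolding qpoch_def by (rule convergent_prod_has_prod)
  then show ?thesis
    by (rule has_prod_imp_tendsto')
qed

lemma qpoch_holomorphic:
  assumes "t > 0"
  shows "(\<lambda>q. qpoch (c * q ^ r) (q ^ t)) holomorphic_on ball 0 1"
proof (rule holomorphic_uniform_sequence[OF open_ball])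
  let ?f = "\<lambda>N q. \<Prod>n<N. 1 - (c * q ^ r) * (q ^ t) ^ n"
  have small: "norm (q ^ t) < 1" if "norm q < 1" for q :: complex
    using that assms by (simp add: norm_power power_less_one_iff)
  show "?f N holomorphic_on ball 0 1" for N
    by (intro holomorphic_intros)
  fix z :: complex
  assume z: "z \<in> ball 0 1"
  define d where "d = (1 - norm z) / 2"
  define \<rho> where "\<rho> = norm z + d"
  have d: "d > 0" and \<rho>: "0 \<le> \<rho>" "\<rho> < 1"
    using z norm_ge_zero[of z] unfolding d_def \<rho>_def by (simp_all add: field_simps del: norm_ge_zero)
  have le: "norm q \<le> \<rho>" if "q \<in> cball z d" for q
    using that norm_triangle_sub[of q z] by (simp add: \<rho>_def dist_norm norm_minus_commute)
  have "uniformly_convergent_on (cball z d) (\<lambda>N q. \<Sum>n<N. norm (1 - (c * q ^ r) * (q ^ t) ^ n - 1))"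
  proof (rule Weierstrass_m_test'[where M = "\<lambda>n. norm c * \<rho> ^ n"])
    show "summable (\<lambda>n. norm c * \<rho> ^ n)"
      using \<rho> by (intro summable_mult summable_geometric) auto
    fix n q
    assume "q \<in> cball z d"
    then have q: "norm q \<le> \<rho>" by (rule le)
    have "norm q ^ r * (norm q ^ t) ^ n \<le> 1 * \<rho> ^ n"
    proof (intro mult_mono power_mono)
      show "norm q ^ r \<le> 1"
        using q \<rho> by (intro power_le_one) auto
      have "norm q ^ t \<le> norm q ^ 1"
        using q \<rho> assms by (intro power_decreasing) auto
      then show "norm q ^ t \<le> \<rho>"
        using q by simp
    qed auto
    then show "norm (norm (1 - (c * q ^ r) * (q ^ t) ^ n - 1)) \<le> norm c * \<rho> ^ n"
      by (simp add: norm_mult norm_power mult.assoc mult_left_mono)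
  qed
  then have "uniformly_convergent_on (cball z d) ?f"
    by (intro uniformly_convergent_on_prod') (auto intro!: continuous_intros)
  then obtain l where l: "uniform_limit (cball z d) ?f l sequentially"
    by (auto simp: uniformly_convergent_on_def)
  have l_eq: "l q = qpoch (c * q ^ r) (q ^ t)" if "q \<in> cball z d" for q
  proof (rule LIMSEQ_unique)
    show "(\<lambda>N. ?f N q) \<longlonglongrightarrow> l q"
      using tendsto_uniform_limitI[OF l that] .
    show "(\<lambda>N. ?f N q) \<longlonglongrightarrow> qpoch (c * q ^ r) (q ^ t)"
      using le[OF that] \<rho> by (intro qpoch_factors_tendsto small) auto
  qed
  have "uniform_limit (cball z d) ?f (\<lambda>q. qpoch (c * q ^ r) (q ^ t)) sequentially"
    by (rule iffD1[OF uniform_limit_cong'[OF refl l_eq] l])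
  moreover have "cball z d \<subseteq> ball 0 1"
  proof
    fix q assume "q \<in> cball z d"
    from le[OF this] \<rho> show "q \<in> ball 0 1" by simp
  qed
  ultimately show "\<exists>d>0. cball z d \<subseteq> ball 0 1 \<and>
      uniform_limit (cball z d) ?f (\<lambda>q. qpoch (c * q ^ r) (q ^ t)) sequentially"
    using d by blast
qed

lemma power_series_on_unit_disc_unique:
  assumes "power_series_on_unit_disc c f" "power_series_on_unit_disc c' f"
  shows "c = c'"
proof -
  have *: "f has_fps_expansion Abs_fps b" if b: "power_series_on_unit_disc b f" for b
  proof (rule has_fps_expansionI)
    have "eventually (\<lambda>u. u \<in> ball 0 1) (nhds (0 :: complex))"
      by (rule eventually_nhds_in_open) simp_all
    moreover have "(\<lambda>n. fps_nth (Abs_fps b) n * u ^ n) sums f u" if "u \<in> ball 0 1" for u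
    proof -
      have "norm u < 1" using that by simp
      then show ?thesis using b unfolding power_series_on_unit_disc_def fps_nth_Abs_fps by blast
    qed
    ultimately show "eventually (\<lambda>u. (\<lambda>n. fps_nth (Abs_fps b) n * u ^ n) sums f u) (nhds 0)"
      by (rule eventually_mono)
  qed
  have "Abs_fps c = Abs_fps c'"
    by (rule fps_expansion_unique_complex[OF *[OF assms(1)] *[OF assms(2)]])
  then show ?thesis
    by (simp add: Abs_fps_inject)
qed

lemma holomorphic_imp_ex1_power_series_on_unit_disc:
  assumes "f holomorphic_on ball 0 1"
  shows "\<exists>!c. power_series_on_unit_disc c f"
proof (rule ex_ex1I)
  show "\<exists>c. power_series_on_unit_disc c f"
  proof
    show "power_series_on_unit_disc (\<lambda>n. (deriv ^^ n) f 0 / fact n) f"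
      using holomorphic_power_series[OF assms] by (simp add: power_series_on_unit_disc_def)
  qed
qed (rule power_series_on_unit_disc_unique)

lemma
  assumes "t > 0"
  shows g_prod_holomorphic: "g_prod r s t holomorphic_on ball 0 1"
    and h_prod_holomorphic: "h_prod r s t holomorphic_on ball 0 1"
proof -
  have 1: "(\<lambda>q. qpoch (- (q ^ k)) (q ^ t)) holomorphic_on ball 0 1" for k
    using qpoch_holomorphic[OF assms, of "-1" k] by simp
  have 2: "(\<lambda>q. qpoch (q ^ k) (q ^ (2 * t))) holomorphic_on ball 0 1" for k
    using qpoch_holomorphic[of "2 * t" 1 k] assms by simp
  show "g_prod r s t holomorphic_on ball 0 1"
    unfolding g_prod_def[abs_def]
    by (intro holomorphic_on_mult holomorphic_on_power 1 2)
  show "h_prod r s t holomorphic_on ball 0 1"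
    unfolding h_prod_def[abs_def]
    by (intro holomorphic_on_mult holomorphic_on_power 1 2)
qed

lemma g_coeff_power_series: "t > 0 \<Longrightarrow> power_series_on_unit_disc (g_coeff r s t) (g_prod r s t)"
  unfolding g_coeff_def
  by (rule theI'[OF holomorphic_imp_ex1_power_series_on_unit_disc[OF g_prod_holomorphic]])

lemma h_coeff_power_series: "t > 0 \<Longrightarrow> power_series_on_unit_disc (h_coeff r s t) (h_prod r s t)"
  unfolding h_coeff_def
  by (rule theI'[OF holomorphic_imp_ex1_power_series_on_unit_disc[OF h_prod_holomorphic]])

end

theory Submission
  imports Defs
begin

text \<open>
  By the Jacobi triple product, each pair of factors in \<open>g_prod r s 5\<close> or
  \<open>h_prod r s 5\<close> is a theta series divided by \<open>(q^5; q^5)\<close> or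
  \<open>(q^10; q^10)\<close>. These divisors are power series in \<open>q^5\<close>, and the same ones
  occur for all \<open>r\<close> and \<open>s\<close>. Multiplication by a power series in
  \<open>q^5\<close> acts on each residue class of exponents modulo 5 separately, so it suffices to
  compare the coefficients of products of four theta series. Such a coefficient is a signed count of the
  points \<open>(x, y, z, w)\<close> of \<open>\<int>\<^sup>4\<close> at which a quadratic polynomial
  takes a given value.

  Completing the square turns the points into vectors \<open>(X, Y, Z, W)\<close> in a fixed residue class
  modulo 10, with \<open>X = 10 x + 2 r - 5\<close> for a factor in base \<open>q^5\<close> and
  \<open>W = 10 w + s - 5\<close> for a factor in base \<open>q^10\<close>. Up to a factor 40 and a
  constant, the polynomial becomes \<open>Q = X\<^sup>2 + Y\<^sup>2 + Z\<^sup>2 + 2 W\<^sup>2\<close> in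
  the case of \<open>g\<close> and \<open>Q = X\<^sup>2 + 2 (Y\<^sup>2 + Z\<^sup>2 + W\<^sup>2)\<close> in
  the case of \<open>h\<close>. For the pairs \<open>(r, s)\<close> in question, the residue class is,
  modulo 5, a multiple of an isotropic vector which lifts to an integer vector \<open>u\<close> with
  \<open>Q u = 5\<close> (for \<open>g\<close>: \<open>u = (1, 1, 1, \<plusminus>1)\<close>) or
  \<open>Q u = 10\<close> (for \<open>h\<close>: \<open>u = (\<plusminus>2, 1, 1, 1)\<close>). The vectors
  of the class have an inner product with \<open>u\<close> that is divisible by 5, so the reflection in
  \<open>u\<close> maps them to integer vectors of the same norm. If the vector is \<open>c u\<close>
  modulo 5 and its reflection is \<open>c' u\<close>, then \<open>c c'\<close> is determined by
  \<open>Q / 5\<close> modulo 5. Hence fixing the exponent modulo 5 fixes the class of the reflected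
  vector, and up to changes of sign of some coordinates this is the class that belongs to the other side
  of the identity. The coordinates that carry the sign of a point change by multiples of 2 that are known
  modulo 4, so the sign is multiplied by a constant.
\<close>

section \<open>Triangular numbers\<close>

text \<open>
  The numbers \<open>tri j\<close> and \<open>tri (j - 1)\<close> are the exponents of \<open>a\<close>
  and \<open>b\<close> in Ramanujan's theta function \<open>f (a, b)\<close>. Both are natural numbers for
  every integer \<open>j\<close>, so no negative powers occur and \<open>q = 0\<close> is no exception.
\<close>

definition tri :: "int \<Rightarrow> nat" where
  "tri j = nat (j * (j + 1) div 2)"

lemma two_tri: "2 * int (tri j) = j * (j + 1)"
proof -
  have "j * (j + 1) \<ge> 0"
    by (cases "j \<ge> 0") (simp_all add: mult_nonpos_nonpos)
  moreover have "even (j * (j + 1))" by simp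
  ultimately show ?thesis
    unfolding tri_def by simp
qed

lemma tri_pred: "int (tri j) = int (tri (j - 1)) + j"
  using two_tri[of j] two_tri[of "j - 1"] by (simp add: algebra_simps)

lemma tri_uminus: "tri (- j) = tri (j - 1)"
  unfolding tri_def by (simp add: algebra_simps)

lemma tri_add_tri_pred: "int (tri j + tri (j - 1)) = j * j"
  using two_tri[of j] two_tri[of "j - 1"] by (simp add: algebra_simps)

lemma nat_abs_le_tri: "nat \<bar>j\<bar> \<le> tri j + tri (j - 1)"
proof -
  have "\<bar>j\<bar> * 1 \<le> \<bar>j\<bar> * \<bar>j\<bar>"
  proof (cases "j = 0")
    case False
    then show ?thesis by (intro mult_left_mono) auto
  qed simp
  then have "\<bar>j\<bar> \<le> int (tri j + tri (j - 1))"
    unfolding tri_add_tri_pred by (simp flip: abs_mult)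
  then show ?thesis by linarith
qed

section \<open>Gaussian binomial coefficients\<close>

definition qfac :: "complex \<Rightarrow> nat \<Rightarrow> complex" where
  "qfac q n = (\<Prod>k<n. 1 - q * q ^ k)"

text \<open>
  The lower index is an integer and the value is 0 outside \<open>{0..m}\<close>, so that the Pascal rule
  holds for all \<open>i\<close> and the boundary terms of the sums below need no separate treatment.
\<close>

definition qbinom :: "complex \<Rightarrow> nat \<Rightarrow> int \<Rightarrow> complex" where
  "qbinom q m i =
     (if 0 \<le> i \<and> i \<le> int m then qfac q m / (qfac q (nat i) * qfac q (nat (int m - i))) else 0)"

lemma one_minus_power_nonzero:
  fixes q :: complex
  assumes "norm q < 1"
  shows "1 - q * q ^ k \<noteq> 0"
proof
  assume "1 - q * q ^ k = 0"
  then have "norm (q ^ Suc k) = 1" by simp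
  moreover have "norm (q ^ Suc k) < 1"
    unfolding norm_power using assms by (simp add: power_less_one_iff del: power_Suc)
  ultimately show False by simp
qed

lemma qfac_nonzero: "norm q < 1 \<Longrightarrow> qfac q n \<noteq> 0"
  unfolding qfac_def using one_minus_power_nonzero by (simp add: prod_zero_iff)

lemma qpoch_self_nonzero:
  assumes "norm q < 1"
  shows "qpoch q q \<noteq> 0"
proof -
  have "summable (\<lambda>n. norm q * norm q ^ n)"
    using assms by (intro summable_mult summable_geometric) auto
  then have "abs_convergent_prod (\<lambda>n. 1 - q * q ^ n)"
    by (simp add: abs_convergent_prod_conv_summable norm_mult norm_power)
  then have "convergent_prod (\<lambda>n. 1 - q * q ^ n)"
    by (rule abs_convergent_prod_imp_convergent_prod)
  then show ?thesis
    unfolding qpoch_def by (rule prodinf_nonzero) (rule one_minus_power_nonzero[OF assms])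
qed

lemma qbinom_symmetric: "qbinom q m (int m - i) = qbinom q m i"
  unfolding qbinom_def by (auto simp: mult.commute)

text \<open>
  The interior case is
  \<open>1 - q ^ (p + r + 2) = (1 - q ^ (r + 1)) + q ^ (r + 1) * (1 - q ^ (p + 1))\<close>, where
  \<open>p + 1\<close> and \<open>r + 1\<close> are the lengths of the two factors \<open>qfac\<close>
  below the fraction bar on the left.
\<close>

lemma qbinom_Suc:
  assumes "norm q < 1"
  shows "qbinom q (Suc m) i = qbinom q m i + q ^ nat (int m + 1 - i) * qbinom q m (i - 1)"
proof -
  note nz = qfac_nonzero[OF assms]
  have Suc: "qfac q (Suc n) = qfac q n * (1 - q ^ Suc n)" for n
    by (simp add: qfac_def)
  have qfac_0: "qfac q 0 = 1"
    by (simp add: qfac_def)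
  consider "i < 0" | "i = 0" | "0 < i" "i \<le> int m" | "i = int m + 1" | "i > int m + 1"
    by linarith
  then show ?thesis
  proof cases
    case 3
    define p where "p = nat (i - 1)"
    define r where "r = nat (int m - i)"
    have i: "i = int p + 1" and m: "m = p + r + 1"
      using 3 by (auto simp: p_def r_def)
    have n: "nat (int p + 1) = Suc p" "nat (int (p + r + 1) - (int p + 1)) = r"
        "nat (int (Suc (p + r + 1)) - (int p + 1)) = Suc r"
        "nat (int (p + r + 1) + 1 - (int p + 1)) = Suc r" "nat (int p + 1 - 1) = p"
        "nat (int (p + r + 1) - (int p + 1 - 1)) = Suc r"
      by auto
    have "qfac q (Suc p) \<noteq> 0" "qfac q (Suc r) \<noteq> 0" "qfac q p \<noteq> 0" "qfac q r \<noteq> 0"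
      by (rule nz)+
    then have f: "1 - q ^ Suc p \<noteq> 0" "1 - q ^ Suc r \<noteq> 0" "qfac q p \<noteq> 0" "qfac q r \<noteq> 0"
      unfolding Suc by auto
    have "q ^ Suc (p + r + 1) = q ^ Suc p * q ^ Suc r"
      by (simp add: power_add mult_ac)
    then have "qfac q (Suc (p + r + 1)) = qfac q (p + r + 1) * (1 - q ^ Suc p * q ^ Suc r)"
      unfolding Suc[of "p + r + 1"] by simp
    then have "qfac q (Suc (p + r + 1)) / (qfac q (Suc p) * qfac q (Suc r)) =
        qfac q (p + r + 1) / (qfac q (Suc p) * qfac q r) +
        q ^ Suc r * (qfac q (p + r + 1) / (qfac q p * qfac q (Suc r)))"
      unfolding Suc[of p] Suc[of r] using f
      by (simp add: divide_simps del: power_Suc) (simp add: algebra_simps del: power_Suc)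
    then show ?thesis
      unfolding qbinom_def i m n by simp
  qed (simp_all add: qbinom_def nat_add_distrib nz qfac_0)
qed

lemma qfac_tendsto: "norm q < 1 \<Longrightarrow> qfac q \<longlonglongrightarrow> qpoch q q"
  unfolding qfac_def by (rule qpoch_factors_tendsto)

text \<open>
  Both \<open>qfac q n\<close> and its inverse converge, because the limit \<open>(q; q)\<close> is not 0;
  so both are bounded.
\<close>

lemma qbinom_bounded:
  assumes "norm q < 1"
  shows "\<exists>K. \<forall>m i. norm (qbinom q m i) \<le> K"
proof -
  have "Bseq (qfac q)"
    using qfac_tendsto[OF assms] by (intro convergent_imp_Bseq convergentI)
  then obtain K1 where K1: "K1 > 0" "\<And>n. norm (qfac q n) \<le> K1"
    by (auto simp: Bseq_def)
  have "(\<lambda>n. inverse (qfac q n)) \<longlonglongrightarrow> inverse (qpoch q q)"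
    by (intro tendsto_inverse qfac_tendsto qpoch_self_nonzero assms)
  then have "Bseq (\<lambda>n. inverse (qfac q n))"
    by (intro convergent_imp_Bseq convergentI)
  then obtain K2 where K2: "K2 > 0" "\<And>n. norm (inverse (qfac q n)) \<le> K2"
    by (auto simp: Bseq_def)
  have "norm (qbinom q m i) \<le> K1 * (K2 * K2)" for m i
  proof (cases "0 \<le> i \<and> i \<le> int m")
    case True
    then have "norm (qbinom q m i) = norm (qfac q m) *
        (norm (inverse (qfac q (nat i))) * norm (inverse (qfac q (nat (int m - i)))))"
      by (simp add: qbinom_def norm_divide norm_mult divide_inverse norm_inverse)
    also have "\<dots> \<le> K1 * (K2 * K2)"
      using K1 K2 by (intro mult_mono) (auto intro: less_imp_le)
    finally show ?thesis .
  next
    case False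
    then have "qbinom q m i = 0"
      unfolding qbinom_def by (rule if_not_P)
    then show ?thesis using K1 K2 by simp
  qed
  then show ?thesis by blast
qed

lemma central_qbinom_tendsto:
  assumes "norm q < 1"
  shows "(\<lambda>N. qbinom q (N + N) (int N + j)) \<longlonglongrightarrow> inverse (qpoch q q)"
proof -
  have fl: "filterlim (\<lambda>N. N + N) at_top sequentially"
    "filterlim (\<lambda>N. nat (int N + j)) at_top sequentially"
    "filterlim (\<lambda>N. nat (int N - j)) at_top sequentially"
  proof -
    show "filterlim (\<lambda>N. N + N) at_top sequentially"
      unfolding filterlim_at_top
    proof
      fix Z :: nat show "\<forall>\<^sub>F N in sequentially. Z \<le> N + N"
        by (rule eventually_sequentiallyI[of Z]) linarith
    qed
    show "filterlim (\<lambda>N. nat (int N + j)) at_top sequentially"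
      unfolding filterlim_at_top
    proof
      fix Z show "\<forall>\<^sub>F N in sequentially. Z \<le> nat (int N + j)"
        by (rule eventually_sequentiallyI[of "Z + nat \<bar>j\<bar>"]) linarith
    qed
    show "filterlim (\<lambda>N. nat (int N - j)) at_top sequentially"
      unfolding filterlim_at_top
    proof
      fix Z show "\<forall>\<^sub>F N in sequentially. Z \<le> nat (int N - j)"
        by (rule eventually_sequentiallyI[of "Z + nat \<bar>j\<bar>"]) linarith
    qed
  qed
  note lim = filterlim_compose[OF qfac_tendsto[OF assms]]
  have "(\<lambda>N. qfac q (N + N) / (qfac q (nat (int N + j)) * qfac q (nat (int N - j))))
      \<longlonglongrightarrow> qpoch q q / (qpoch q q * qpoch q q)"
    using qpoch_self_nonzero[OF assms] by (intro tendsto_intros lim fl) auto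
  moreover have "\<forall>\<^sub>F N in sequentially.
      qfac q (N + N) / (qfac q (nat (int N + j)) * qfac q (nat (int N - j))) =
      qbinom q (N + N) (int N + j)"
  proof (rule eventually_sequentiallyI[of "nat \<bar>j\<bar>"])
    fix N assume "nat \<bar>j\<bar> \<le> N"
    moreover have "int (N + N) - (int N + j) = int N - j" by simp
    ultimately show "qfac q (N + N) / (qfac q (nat (int N + j)) * qfac q (nat (int N - j))) =
        qbinom q (N + N) (int N + j)"
      unfolding qbinom_def by auto
  qed
  ultimately have "(\<lambda>N. qbinom q (N + N) (int N + j)) \<longlonglongrightarrow> qpoch q q / (qpoch q q * qpoch q q)"
    by (rule Lim_transform_eventually)
  then show ?thesis
    using qpoch_self_nonzero[OF assms] by (simp add: inverse_eq_divide)
qed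

section \<open>The Jacobi triple product\<close>

definition theta_term :: "complex \<Rightarrow> complex \<Rightarrow> int \<Rightarrow> complex" where
  "theta_term a b j = a ^ tri j * b ^ tri (j - 1)"

lemma theta_term_uminus: "theta_term a b (- j) = theta_term b a j"
  unfolding theta_term_def using tri_uminus[of j] tri_uminus[of "j + 1"]
  by (simp add: mult.commute)

text \<open>
  This is \<open>theta_term a b j = a ^ j * b ^ (j - 1) * theta_term a b (j - 1)\<close>, multiplied by a
  power of \<open>a * b\<close> that is large enough to make all exponents nonnegative.
\<close>

lemma theta_term_pred:
  assumes "j \<le> int M + 1"
  shows "a * (a * b) ^ M * theta_term a b (j - 1) = (a * b) ^ nat (int M + 1 - j) * theta_term a b j"
proof -
  have "Suc (M + tri (j - 1)) = nat (int M + 1 - j) + tri j"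
    using assms tri_pred[of j] by linarith
  moreover have "M + tri (j - 1 - 1) = nat (int M + 1 - j) + tri (j - 1)"
    using assms tri_pred[of "j - 1"] by linarith
  moreover have "a * (a * b) ^ M * theta_term a b (j - 1) = a ^ Suc (M + tri (j - 1)) * b ^ (M + tri (j - 1 - 1))"
    by (simp add: theta_term_def power_add power_mult_distrib mult_ac)
  moreover have "(a * b) ^ nat (int M + 1 - j) * theta_term a b j =
      a ^ (nat (int M + 1 - j) + tri j) * b ^ (nat (int M + 1 - j) + tri (j - 1))"
    by (simp add: theta_term_def power_add power_mult_distrib mult_ac)
  ultimately show ?thesis by simp
qed

text \<open>
  The two numbers of factors vary independently: then a single Pascal rule handles one more factor of the
  first kind, and the symmetry between \<open>a\<close> and \<open>b\<close> does the rest.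
\<close>

definition triple_product_identity :: "complex \<Rightarrow> complex \<Rightarrow> nat \<Rightarrow> nat \<Rightarrow> bool" where
  "triple_product_identity a b M N \<longleftrightarrow>
     (\<Prod>k<M. 1 + a * (a * b) ^ k) * (\<Prod>k<N. 1 + b * (a * b) ^ k) =
     (\<Sum>j\<in>{- int N..int M}. qbinom (a * b) (M + N) (int N + j) * theta_term a b j)"

lemma finite_triple_product_swap:
  assumes "triple_product_identity a b M N"
  shows "triple_product_identity b a N M"
proof -
  have "(\<Sum>j\<in>{- int N..int M}. qbinom (a * b) (M + N) (int N + j) * theta_term a b j) =
        (\<Sum>j\<in>{- int M..int N}. qbinom (b * a) (N + M) (int M + j) * theta_term b a j)"
  proof (rule sum.reindex_bij_witness[of _ uminus uminus])
    fix j
    have "qbinom (a * b) (M + N) (int (M + N) - (int N + j)) = qbinom (a * b) (M + N) (int N + j)"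
      by (rule qbinom_symmetric)
    then show "qbinom (b * a) (N + M) (int M + - j) * theta_term b a (- j) =
        qbinom (a * b) (M + N) (int N + j) * theta_term a b j"
      by (simp add: theta_term_uminus mult.commute add.commute)
  qed auto
  then show ?thesis
    using assms unfolding triple_product_identity_def by (simp add: mult_ac)
qed

lemma finite_triple_product_Suc:
  assumes q: "norm (a * b) < 1" and IH: "triple_product_identity a b M N"
  shows "triple_product_identity a b (Suc M) N"
proof -
  let ?B = "\<lambda>j. qbinom (a * b) (M + N) (int N + j)" and ?t = "theta_term a b"
  let ?A = "{- int N..int (Suc M)}"
  have out: "?B j = 0" if "j < - int N \<or> j > int M" for j
    using that by (auto simp: qbinom_def)
  have shift: "(\<Sum>j\<in>{- int N..int M}. a * (a * b) ^ M * (?B j * ?t j)) =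
      (\<Sum>j\<in>{- int N + 1..int (Suc M)}. a * (a * b) ^ M * (?B (j - 1) * ?t (j - 1)))"
    by (rule sum.reindex_bij_witness[of _ "\<lambda>j. j - 1" "\<lambda>j. j + 1"]) auto
  have "(\<Prod>k<Suc M. 1 + a * (a * b) ^ k) * (\<Prod>k<N. 1 + b * (a * b) ^ k) =
      (1 + a * (a * b) ^ M) * (\<Sum>j\<in>{- int N..int M}. ?B j * ?t j)"
    using IH unfolding triple_product_identity_def by simp
  also have "\<dots> = (\<Sum>j\<in>{- int N..int M}. ?B j * ?t j) +
      (\<Sum>j\<in>{- int N + 1..int (Suc M)}. a * (a * b) ^ M * (?B (j - 1) * ?t (j - 1)))"
    unfolding shift[symmetric] by (simp only: distrib_right mult_1 sum_distrib_left[symmetric])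
  also have "(\<Sum>j\<in>{- int N..int M}. ?B j * ?t j) = (\<Sum>j\<in>?A. ?B j * ?t j)"
    by (rule sum.mono_neutral_left) (auto simp: out)
  also have "(\<Sum>j\<in>{- int N + 1..int (Suc M)}. a * (a * b) ^ M * (?B (j - 1) * ?t (j - 1))) =
      (\<Sum>j\<in>?A. a * (a * b) ^ M * (?B (j - 1) * ?t (j - 1)))"
    by (rule sum.mono_neutral_left) (auto simp: out)
  also have "(\<Sum>j\<in>?A. ?B j * ?t j) + (\<Sum>j\<in>?A. a * (a * b) ^ M * (?B (j - 1) * ?t (j - 1))) =
      (\<Sum>j\<in>?A. qbinom (a * b) (Suc M + N) (int N + j) * ?t j)"
    unfolding sum.distrib[symmetric]
  proof (rule sum.cong[OF refl])
    fix j assume "j \<in> ?A"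
    then have "a * (a * b) ^ M * ?t (j - 1) = (a * b) ^ nat (int M + 1 - j) * ?t j"
      by (intro theta_term_pred) auto
    then have *: "a * (a * b) ^ M * (?B (j - 1) * ?t (j - 1)) =
        (a * b) ^ nat (int M + 1 - j) * ?B (j - 1) * ?t j"
      by (simp add: mult_ac)
    have e: "int (M + N) + 1 - (int N + j) = int M + 1 - j" "int N + j - 1 = int N + (j - 1)"
      "Suc M + N = Suc (M + N)"
      by auto
    show "?B j * ?t j + a * (a * b) ^ M * (?B (j - 1) * ?t (j - 1)) =
        qbinom (a * b) (Suc M + N) (int N + j) * ?t j"
      unfolding * e(3) qbinom_Suc[OF q] e(1,2) by (simp add: distrib_right)
  qed
  finally show ?thesis
    unfolding triple_product_identity_def .
qed

lemma finite_triple_product: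
  assumes "norm (a * b) < 1"
  shows "triple_product_identity a b M N"
proof -
  have zero: "triple_product_identity c d 0 0" for c d
    by (simp add: triple_product_identity_def qbinom_def theta_term_def tri_def qfac_def)
  have left: "triple_product_identity b a M 0" for M
    using assms by (induction M) (auto simp: mult.commute intro: zero finite_triple_product_Suc)
  show ?thesis
    using assms by (induction M) (auto intro: finite_triple_product_swap left finite_triple_product_Suc)
qed

text \<open>
  The general dominated convergence theorem, for the counting measure.
\<close>

lemma tendsto_infsum_dominated:
  fixes f :: "nat \<Rightarrow> 'a \<Rightarrow> complex"
  assumes lim: "\<And>i. (\<lambda>n. f n i) \<longlonglongrightarrow> g i"
    and bound: "\<And>n i. norm (f n i) \<le> M i"
    and M: "M summable_on UNIV"
  shows "(\<lambda>n. infsum (f n) UNIV) \<longlonglongrightarrow> infsum g UNIV" "g summable_on UNIV"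
proof -
  have M0: "0 \<le> M i" for i
    using order.trans[OF norm_ge_zero bound] .
  have "(\<lambda>i. norm (M i)) summable_on UNIV"
    using M M0 by simp
  then have iM: "integrable (count_space UNIV) M"
    unfolding abs_summable_equivalent abs_summable_on_def .
  have gb: "norm (g i) \<le> M i" for i
    by (rule LIMSEQ_le_const2[OF tendsto_norm[OF lim]]) (use bound in auto)
  have fa: "Infinite_Set_Sum.abs_summable_on (f n) UNIV" for n
    unfolding abs_summable_on_def by (rule Bochner_Integration.integrable_bound[OF iM]) (use bound M0 in auto)
  have ga: "Infinite_Set_Sum.abs_summable_on g UNIV"
    unfolding abs_summable_on_def by (rule Bochner_Integration.integrable_bound[OF iM]) (use gb M0 in auto)
  have "(\<lambda>n. infsetsum (f n) UNIV) \<longlonglongrightarrow> infsetsum g UNIV"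
    unfolding infsetsum_def
    by (rule integral_dominated_convergence[OF _ _ iM]) (use lim bound in auto)
  then show "(\<lambda>n. infsum (f n) UNIV) \<longlonglongrightarrow> infsum g UNIV"
    using fa ga by (simp add: infsetsum_infsum)
  show "g summable_on UNIV"
    using ga by (simp add: abs_summable_summable abs_summable_equivalent)
qed

lemma summable_on_power_nat_abs:
  fixes \<rho> :: real
  assumes "0 \<le> \<rho>" "\<rho> < 1"
  shows "(\<lambda>j :: int. \<rho> ^ nat \<bar>j\<bar>) summable_on UNIV"
proof -
  have s: "(\<lambda>n :: nat. \<rho> ^ n) summable_on UNIV"
    using assms by (intro norm_summable_imp_summable_on) (simp add: summable_geometric)
  have "(\<lambda>j :: int. \<rho> ^ nat \<bar>j\<bar>) summable_on range int"
    by (subst summable_on_reindex) (use s in \<open>auto simp: o_def\<close>)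
  moreover have "(\<lambda>j :: int. \<rho> ^ nat \<bar>j\<bar>) summable_on range (\<lambda>n. - int n)"
    by (subst summable_on_reindex) (use s in \<open>auto simp: o_def inj_on_def\<close>)
  ultimately have "(\<lambda>j :: int. \<rho> ^ nat \<bar>j\<bar>) summable_on (range int \<union> range (\<lambda>n. - int n))"
    by (rule summable_on_union)
  moreover have "range int \<union> range (\<lambda>n. - int n) = UNIV"
    by (auto simp: image_iff) (metis int_cases2)
  ultimately show ?thesis by simp
qed

lemma norm_theta_term_le:
  assumes "norm a \<le> \<rho>" "norm b \<le> \<rho>" "\<rho> \<le> 1"
  shows "norm (theta_term a b j) \<le> \<rho> ^ nat \<bar>j\<bar>"
proof -
  have \<rho>: "0 \<le> \<rho>" using order.trans[OF norm_ge_zero assms(1)] .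
  have "norm (theta_term a b j) \<le> \<rho> ^ tri j * \<rho> ^ tri (j - 1)"
    unfolding theta_term_def norm_mult norm_power
    using assms \<rho> by (intro mult_mono power_mono) auto
  also have "\<dots> \<le> \<rho> ^ nat \<bar>j\<bar>"
    unfolding power_add[symmetric]
    by (rule power_decreasing[OF nat_abs_le_tri \<rho> assms(3)])
  finally show ?thesis .
qed

text \<open>
  With \<open>N\<close> factors of each kind, the coefficient of \<open>theta_term a b j\<close> in the
  finite identity is a central Gaussian binomial coefficient. As \<open>N\<close> grows, it tends to
  \<open>1 / (a b; a b)\<close> and stays bounded, so dominated convergence applies.
\<close>

theorem jacobi_triple_product:
  assumes a: "norm a < 1" and b: "norm b < 1"
  shows "(theta_term a b has_sum
           qpoch (- a) (a * b) * qpoch (- b) (a * b) * qpoch (a * b) (a * b)) UNIV"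
proof -
  define \<rho> where "\<rho> = max (norm a) (norm b)"
  have \<rho>: "norm a \<le> \<rho>" "norm b \<le> \<rho>" "0 \<le> \<rho>" "\<rho> < 1"
    using a b by (auto simp: \<rho>_def le_max_iff_disj)
  have q: "norm (a * b) < 1"
    using mult_strict_mono'[OF a b] by (simp add: norm_mult)
  let ?q = "a * b"
  define f where "f N j = qbinom ?q (N + N) (int N + j) * theta_term a b j" for N :: nat and j
  obtain K where K: "\<And>m i. norm (qbinom ?q m i) \<le> K"
    using qbinom_bounded[OF q] by blast
  have "(\<lambda>N. f N j) \<longlonglongrightarrow> inverse (qpoch ?q ?q) * theta_term a b j" for j
    unfolding f_def by (intro tendsto_intros central_qbinom_tendsto q)
  moreover have "norm (f N j) \<le> K * \<rho> ^ nat \<bar>j\<bar>" for N j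
    unfolding f_def norm_mult
    using K norm_theta_term_le[OF \<rho>(1,2)] \<rho> order.trans[OF norm_ge_zero K]
    by (intro mult_mono) auto
  moreover have "(\<lambda>j. K * \<rho> ^ nat \<bar>j\<bar>) summable_on UNIV"
    using \<rho> by (intro summable_on_cmult_right summable_on_power_nat_abs)
  ultimately have lim: "(\<lambda>N. infsum (f N) UNIV) \<longlonglongrightarrow>
      (\<Sum>\<^sub>\<infinity>j. inverse (qpoch ?q ?q) * theta_term a b j)"
    and summ: "(\<lambda>j. inverse (qpoch ?q ?q) * theta_term a b j) summable_on UNIV"
    by (rule tendsto_infsum_dominated)+
  have "infsum (f N) UNIV = (\<Prod>k<N. 1 - (- a) * ?q ^ k) * (\<Prod>k<N. 1 - (- b) * ?q ^ k)" for N
  proof -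
    have "infsum (f N) UNIV = infsum (f N) {- int N..int N}"
      by (rule infsum_cong_neutral) (auto simp: f_def qbinom_def)
    then show ?thesis
      using finite_triple_product[OF q, of N N]
      by (simp add: triple_product_identity_def f_def)
  qed
  moreover have "(\<lambda>N. (\<Prod>k<N. 1 - (- a) * ?q ^ k) * (\<Prod>k<N. 1 - (- b) * ?q ^ k))
      \<longlonglongrightarrow> qpoch (- a) ?q * qpoch (- b) ?q"
    by (intro tendsto_mult qpoch_factors_tendsto q)
  ultimately have eq: "(\<Sum>\<^sub>\<infinity>j. inverse (qpoch ?q ?q) * theta_term a b j) =
      qpoch (- a) ?q * qpoch (- b) ?q"
    using lim by (simp add: LIMSEQ_unique)
  have "((\<lambda>j. inverse (qpoch ?q ?q) * theta_term a b j) has_sum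
      qpoch (- a) ?q * qpoch (- b) ?q) UNIV"
    using has_sum_infsum[OF summ] unfolding eq .
  from has_sum_cmult_right[OF this, of "qpoch ?q ?q"] show ?thesis
    using qpoch_self_nonzero[OF q] by (simp add: mult_ac)
qed

section \<open>Theta series in one variable\<close>

text \<open>
  The exponents of \<open>q\<close> in Ramanujan's \<open>f (q ^ r, q ^ (t - r))\<close>.
\<close>

definition theta_exp :: "nat \<Rightarrow> nat \<Rightarrow> int \<Rightarrow> nat" where
  "theta_exp t r j = r * tri j + (t - r) * tri (j - 1)"

lemma two_theta_exp:
  assumes "r \<le> t"
  shows "2 * int (theta_exp t r j) = int t * (j * j) + (2 * int r - int t) * j"
proof -
  have "2 * int (theta_exp t r j) = int r * (2 * int (tri j)) + (int t - int r) * (2 * int (tri (j - 1)))"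
    using assms by (simp add: theta_exp_def of_nat_diff)
  then show ?thesis
    unfolding two_tri by (simp add: algebra_simps)
qed

lemma nat_abs_le_theta_exp:
  assumes "0 < r" "r < t"
  shows "nat \<bar>j\<bar> \<le> theta_exp t r j"
proof -
  have "tri j \<le> r * tri j" "tri (j - 1) \<le> (t - r) * tri (j - 1)"
    using assms by (simp_all add: Suc_le_eq)
  then show ?thesis
    using nat_abs_le_tri[of j] unfolding theta_exp_def by linarith
qed

lemma theta_has_sum:
  assumes r: "0 < r" "r < t" and q: "norm q < 1"
  shows "((\<lambda>j. q ^ theta_exp t r j) has_sum
           qpoch (- (q ^ r)) (q ^ t) * qpoch (- (q ^ (t - r))) (q ^ t) * qpoch (q ^ t) (q ^ t)) UNIV"
proof -
  have "norm (q ^ r) < 1" "norm (q ^ (t - r)) < 1"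
    using r q by (simp_all add: norm_power power_less_one_iff)
  moreover have "q ^ r * q ^ (t - r) = q ^ t"
    using r by (simp flip: power_add)
  moreover have "theta_term (q ^ r) (q ^ (t - r)) = (\<lambda>j. q ^ theta_exp t r j)"
    by (simp add: fun_eq_iff theta_term_def theta_exp_def power_mult power_add)
  ultimately show ?thesis
    using jacobi_triple_product[of "q ^ r" "q ^ (t - r)"] by simp
qed

text \<open>
  The triple product for \<open>- a\<close> and \<open>- b\<close> has the same base \<open>a * b\<close>. It introduces the sign
  \<open>(- 1) ^ (tri j + tri (j - 1)) = (- 1) ^ (j * j)\<close>, and \<open>j * j\<close> has the parity of \<open>j\<close>.
\<close>

lemma alternating_theta_has_sum:
  assumes r: "0 < r" "r < t" and q: "norm q < 1"
  shows "((\<lambda>j. (- 1) powi j * q ^ theta_exp t r j) has_sum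
           qpoch (q ^ r) (q ^ t) * qpoch (q ^ (t - r)) (q ^ t) * qpoch (q ^ t) (q ^ t)) UNIV"
proof -
  have "norm (- (q ^ r)) < 1" "norm (- (q ^ (t - r))) < 1"
    using r q by (simp_all add: norm_power power_less_one_iff)
  moreover have "- (q ^ r) * - (q ^ (t - r)) = q ^ t"
    using r by (simp flip: power_add)
  moreover have "theta_term (- (q ^ r)) (- (q ^ (t - r))) = (\<lambda>j. (- 1) powi j * q ^ theta_exp t r j)"
  proof
    fix j
    have "even (tri j + tri (j - 1)) \<longleftrightarrow> even j"
      unfolding even_of_nat_iff[of "tri j + tri (j - 1)", symmetric, where 'a = int] tri_add_tri_pred by simp
    then have sign: "(- 1) ^ (tri j + tri (j - 1)) = ((- 1) powi j :: complex)"
      by (auto simp: power_int_minus_left minus_one_power_iff)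
    have "theta_term (- (q ^ r)) (- (q ^ (t - r))) j =
        (- 1) ^ (tri j + tri (j - 1)) * q ^ theta_exp t r j"
      unfolding theta_term_def theta_exp_def power_minus[of "q ^ r"] power_minus[of "q ^ (t - r)"]
      by (simp add: power_mult power_add)
    then show "theta_term (- (q ^ r)) (- (q ^ (t - r))) j = (- 1) powi j * q ^ theta_exp t r j"
      unfolding sign .
  qed
  ultimately show ?thesis
    using jacobi_triple_product[of "- (q ^ r)" "- (q ^ (t - r))"] by simp
qed

section \<open>Coefficients of products of theta series\<close>

lemma has_sum_times_product:
  fixes f :: "'a \<Rightarrow> complex" and g :: "'b \<Rightarrow> complex"
  assumes f: "(f has_sum S) UNIV" and g: "(g has_sum T) UNIV"
  shows "((\<lambda>(x, y). f x * g y) has_sum S * T) UNIV"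
proof -
  have fa: "(\<lambda>x. norm (f x)) summable_on UNIV" and ga: "(\<lambda>y. norm (g y)) summable_on UNIV"
    using f g by (auto simp: summable_on_iff_abs_summable_on_complex[symmetric] has_sum_imp_summable)
  have "(\<lambda>(x, y). norm (f x) * norm (g y)) summable_on UNIV \<times> UNIV"
  proof (rule summable_on_SigmaI)
    show "((\<lambda>y. case (x, y) of (x, y) \<Rightarrow> norm (f x) * norm (g y)) has_sum
        norm (f x) * (\<Sum>\<^sub>\<infinity>y. norm (g y))) UNIV" for x
      using has_sum_cmult_right[OF has_sum_infsum[OF ga], of "norm (f x)"] by simp
    show "(\<lambda>x. norm (f x) * (\<Sum>\<^sub>\<infinity>y. norm (g y))) summable_on UNIV"
      by (rule summable_on_cmult_left[OF fa])
  qed auto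
  then have "(\<lambda>z. norm (case z of (x, y) \<Rightarrow> f x * g y)) summable_on UNIV \<times> UNIV"
    by (simp add: case_prod_unfold norm_mult)
  then have summ: "(\<lambda>(x, y). f x * g y) summable_on UNIV \<times> UNIV"
    by (rule abs_summable_summable)
  have "((\<lambda>(x, y). f x * g y) has_sum S * T) (UNIV \<times> UNIV)"
  proof (rule has_sum_SigmaI[OF _ _ summ])
    show "((\<lambda>y. case (x, y) of (x, y) \<Rightarrow> f x * g y) has_sum f x * T) UNIV" for x
      using has_sum_cmult_right[OF g, of "f x"] by simp
    show "((\<lambda>x. f x * T) has_sum S * T) UNIV"
      by (rule has_sum_cmult_left[OF f])
  qed
  then show ?thesis by simp
qed

lemma power_series_collect_exponents:
  fixes c :: "'a \<Rightarrow> complex" and e :: "'a \<Rightarrow> nat"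
  assumes sum: "\<And>q. norm q < 1 \<Longrightarrow> ((\<lambda>i. c i * q ^ e i) has_sum F q) UNIV"
    and fin: "\<And>n. finite {i. e i = n}"
  shows "power_series_on_unit_disc (\<lambda>n. \<Sum>i | e i = n. c i) F"
  unfolding power_series_on_unit_disc_def
proof (intro allI impI)
  fix q :: complex assume "norm q < 1"
  then have "((\<lambda>i. c i * q ^ e i) has_sum F q) UNIV"
    by (rule sum)
  also have "?this \<longleftrightarrow> ((\<lambda>(n, i). c i * q ^ e i) has_sum F q) (SIGMA n:UNIV. {i. e i = n})"
    by (rule has_sum_reindex_bij_witness[of _ snd "\<lambda>i. (e i, i)"]) auto
  finally have "((\<lambda>n. (\<Sum>i | e i = n. c i) * q ^ n) has_sum F q) UNIV"
  proof (rule has_sum_SigmaD)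
    fix n
    show "((\<lambda>i. case (n, i) of (n, i) \<Rightarrow> c i * q ^ e i) has_sum (\<Sum>i | e i = n. c i) * q ^ n)
        {i. e i = n}"
      by (rule has_sum_finiteI[OF fin]) (simp add: sum_distrib_right)
  qed
  then show "(\<lambda>n. (\<Sum>i | e i = n. c i) * q ^ n) sums F q"
    by (rule has_sum_imp_sums)
qed

text \<open>
  The factor \<open>D (q ^ m)\<close> has only exponents divisible by \<open>m\<close>, so in the Cauchy
  product it does not mix the residue classes modulo \<open>m\<close>.
\<close>

lemma power_series_times_power_argument:
  assumes F: "power_series_on_unit_disc a F" and D: "power_series_on_unit_disc d D"
    and g: "power_series_on_unit_disc g (\<lambda>q. F q * D (q ^ m))"
    and k: "k < m"
  shows "g (m * n + k) = (\<Sum>i\<le>n. a (m * i + k) * d (n - i))"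
proof -
  define d' where "d' j = (if m dvd j then d (j div m) else 0)" for j
  have m: "m > 0" using k by simp
  have conv: "summable (\<lambda>n. norm (b n * q ^ n))"
    if b: "power_series_on_unit_disc b G" and q: "norm q < 1" for b G and q :: complex
  proof -
    obtain r where r: "norm q < r" "r < 1" using dense[OF q] by blast
    have "0 \<le> r" using r(1) norm_ge_zero[of q] by linarith
    then have "norm (complex_of_real r) < 1" using r by simp
    then have "summable (\<lambda>n. b n * complex_of_real r ^ n)"
      using b unfolding power_series_on_unit_disc_def by (blast intro: sums_summable)
    then show ?thesis
      by (rule powser_insidea) (use r \<open>0 \<le> r\<close> in simp)
  qed
  have D': "power_series_on_unit_disc d' (\<lambda>q. D (q ^ m))"
    unfolding power_series_on_unit_disc_def
  proof (intro allI impI)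
    fix q :: complex assume "norm q < 1"
    then have "norm (q ^ m) < 1"
      using m by (simp add: norm_power power_less_one_iff)
    then have "(\<lambda>i. d i * (q ^ m) ^ i) sums D (q ^ m)"
      using D by (simp add: power_series_on_unit_disc_def)
    moreover have "(\<lambda>i. d i * (q ^ m) ^ i) = (\<lambda>i. d' (m * i) * q ^ (m * i))"
      using m by (simp add: d'_def power_mult)
    ultimately have "(\<lambda>i. d' (m * i) * q ^ (m * i)) sums D (q ^ m)"
      by simp
    moreover have "strict_mono (\<lambda>i. m * i)"
      using m by (simp add: strict_mono_def)
    ultimately show "(\<lambda>j. d' j * q ^ j) sums D (q ^ m)"
      by (subst (asm) sums_mono_reindex) (auto simp: d'_def dvd_def)
  qed
  define p where "p n = (\<Sum>i\<le>n. a i * d' (n - i))" for n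
  have "power_series_on_unit_disc p (\<lambda>q. F q * D (q ^ m))"
    unfolding power_series_on_unit_disc_def
  proof (intro allI impI)
    fix q :: complex assume q: "norm q < 1"
    have "(\<lambda>n. \<Sum>i\<le>n. (a i * q ^ i) * (d' (n - i) * q ^ (n - i))) sums
        ((\<Sum>n. a n * q ^ n) * (\<Sum>n. d' n * q ^ n))"
      by (rule Cauchy_product_sums[OF conv[OF F q] conv[OF D' q]])
    moreover have "(\<Sum>n. a n * q ^ n) = F q" "(\<Sum>n. d' n * q ^ n) = D (q ^ m)"
      using F D' q by (auto simp: power_series_on_unit_disc_def sums_iff)
    moreover have "(\<Sum>i\<le>n. (a i * q ^ i) * (d' (n - i) * q ^ (n - i))) = p n * q ^ n" for n
      unfolding p_def sum_distrib_right
    proof (rule sum.cong[OF refl])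
      fix i assume "i \<in> {..n}"
      then have "q ^ n = q ^ i * q ^ (n - i)" by (simp flip: power_add)
      then show "(a i * q ^ i) * (d' (n - i) * q ^ (n - i)) = a i * d' (n - i) * q ^ n"
        by simp
    qed
    ultimately show "(\<lambda>n. p n * q ^ n) sums (F q * D (q ^ m))" by simp
  qed
  from power_series_on_unit_disc_unique[OF g this] have "g (m * n + k) = p (m * n + k)"
    by simp
  also have "\<dots> = (\<Sum>j\<in>(\<lambda>i. m * i + k) ` {..n}. a j * d' (m * n + k - j))"
    unfolding p_def
  proof (rule sum.mono_neutral_right)
    show "\<forall>j\<in>{..m * n + k} - (\<lambda>i. m * i + k) ` {..n}. a j * d' (m * n + k - j) = 0"
    proof
      fix j assume j: "j \<in> {..m * n + k} - (\<lambda>i. m * i + k) ` {..n}"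
      have "\<not> m dvd (m * n + k - j)"
      proof
        assume "m dvd (m * n + k - j)"
        then obtain l where l: "m * n + k - j = m * l" ..
        then have *: "m * n + k = m * l + j" using j by auto
        have "l \<le> n"
        proof (rule ccontr)
          assume "\<not> l \<le> n"
          then have "m * Suc n \<le> m * l" by (intro mult_le_mono2) auto
          then show False using * k by simp
        qed
        then have "m * (n - l) + k = j"
          using * by (simp add: diff_mult_distrib2)
        then show False using j by auto
      qed
      then show "a j * d' (m * n + k - j) = 0" by (simp add: d'_def)
    qed
  qed auto
  also have "\<dots> = (\<Sum>i\<le>n. a (m * i + k) * d' (m * n + k - (m * i + k)))"
    using m by (subst sum.reindex) (auto simp: inj_on_def)
  also have "\<dots> = (\<Sum>i\<le>n. a (m * i + k) * d (n - i))"
    using m by (intro sum.cong) (auto simp: d'_def simp flip: diff_mult_distrib2)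
  finally show ?thesis .
qed

lemma inverse_euler_power_series:
  fixes m k :: nat
  shows "\<exists>d. power_series_on_unit_disc d
           (\<lambda>Q. inverse (qpoch Q Q ^ m * qpoch (Q ^ 2) (Q ^ 2) ^ k))"
proof -
  have 1: "(\<lambda>Q. qpoch Q Q) holomorphic_on ball 0 1"
    using qpoch_holomorphic[of 1 1 1] by simp
  have 2: "(\<lambda>Q. qpoch (Q ^ 2) (Q ^ 2)) holomorphic_on ball 0 1"
    using qpoch_holomorphic[of 2 1 2] by simp
  have "qpoch Q Q ^ m * qpoch (Q ^ 2) (Q ^ 2) ^ k \<noteq> 0" if "Q \<in> ball 0 1" for Q
  proof -
    have "norm Q < 1" using that by simp
    moreover from this have "norm (Q ^ 2) < 1"
      by (simp add: norm_power power_less_one_iff)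
    ultimately show ?thesis
      by (simp add: qpoch_self_nonzero)
  qed
  then have "(\<lambda>Q. inverse (qpoch Q Q ^ m * qpoch (Q ^ 2) (Q ^ 2) ^ k)) holomorphic_on ball 0 1"
    by (intro holomorphic_intros 1 2) auto
  then show ?thesis
    using holomorphic_imp_ex1_power_series_on_unit_disc by blast
qed

text \<open>
  The Euler products turn \<open>P\<close> and \<open>P'\<close> into sums over lattice points. As they
  are the same power series in \<open>q ^ t\<close> on both sides, a relation between the lattice sums on
  two residue classes of exponents modulo \<open>t\<close> passes to the coefficients of \<open>P\<close>
  and \<open>P'\<close>.
\<close>

lemma coeff_eq_of_lattice_sum_eq:
  fixes \<sigma> \<sigma>' :: "'a \<Rightarrow> complex" and e e' :: "'a \<Rightarrow> nat" and t i j :: nat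
  defines "euler \<equiv> \<lambda>q. qpoch (q ^ t) (q ^ t) ^ i * qpoch (q ^ (2 * t)) (q ^ (2 * t)) ^ j"
  assumes P: "power_series_on_unit_disc c P" and P': "power_series_on_unit_disc c' P'"
    and sum: "\<And>q. norm q < 1 \<Longrightarrow> ((\<lambda>v. \<sigma> v * q ^ e v) has_sum P q * euler q) UNIV"
    and sum': "\<And>q. norm q < 1 \<Longrightarrow> ((\<lambda>v. \<sigma>' v * q ^ e' v) has_sum P' q * euler q) UNIV"
    and fin: "\<And>n. finite {v. e v = n}" and fin': "\<And>n. finite {v. e' v = n}"
    and eq: "\<And>n. (\<Sum>v | e v = t * n + k. \<sigma> v) = \<epsilon> * (\<Sum>v | e' v = t * n + k'. \<sigma>' v)"
    and k: "k < t" and k': "k' < t"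
  shows "c (t * n + k) = \<epsilon> * c' (t * n + k')"
proof -
  define D where "D Q = inverse (qpoch Q Q ^ i * qpoch (Q ^ 2) (Q ^ 2) ^ j)" for Q
  obtain d where d: "power_series_on_unit_disc d D"
    using inverse_euler_power_series unfolding D_def[abs_def] by blast
  have cancel: "G q * euler q * D (q ^ t) = G q" if q: "norm q < 1" for G :: "complex \<Rightarrow> complex" and q
  proof -
    have "norm (q ^ t) < 1" "norm (q ^ (2 * t)) < 1"
      using q k by (simp_all add: norm_power power_less_one_iff)
    then have "euler q \<noteq> 0"
      by (simp add: euler_def qpoch_self_nonzero)
    moreover have "(q ^ t) ^ 2 = q ^ (2 * t)"
      by (simp add: power_mult[symmetric] mult.commute)
    moreover from this have "D (q ^ t) = inverse (euler q)"
      by (simp add: D_def euler_def)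
    ultimately show ?thesis by simp
  qed
  have euler_cancels: "power_series_on_unit_disc b (\<lambda>q. G q * euler q * D (q ^ t))"
    if G: "power_series_on_unit_disc b G" for b G
    unfolding power_series_on_unit_disc_def
  proof (intro allI impI)
    fix q :: complex assume q: "norm q < 1"
    have "(\<lambda>n. b n * q ^ n) sums G q"
      using G q by (simp add: power_series_on_unit_disc_def)
    then show "(\<lambda>n. b n * q ^ n) sums (G q * euler q * D (q ^ t))"
      unfolding cancel[OF q] .
  qed
  have 1: "c (t * n + k) = (\<Sum>l\<le>n. (\<Sum>v | e v = t * l + k. \<sigma> v) * d (n - l))"
    by (rule power_series_times_power_argument[OF power_series_collect_exponents[OF sum fin] d
          euler_cancels[OF P] k])
  have 2: "c' (t * n + k') = (\<Sum>l\<le>n. (\<Sum>v | e' v = t * l + k'. \<sigma>' v) * d (n - l))"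
    by (rule power_series_times_power_argument[OF power_series_collect_exponents[OF sum' fin'] d
          euler_cancels[OF P'] k'])
  show ?thesis
    unfolding 1 2 eq mult.assoc by (rule sum_distrib_left[symmetric])
qed

section \<open>The lattice sums of the two families\<close>

definition g_exp :: "nat \<Rightarrow> nat \<Rightarrow> nat \<Rightarrow> int \<times> int \<times> int \<times> int \<Rightarrow> nat" where
  "g_exp r s t = (\<lambda>(x, y, z, w).
     theta_exp t r x + (theta_exp t r y + (theta_exp t r z + theta_exp (2 * t) s w)))"

definition g_sign :: "int \<times> int \<times> int \<times> int \<Rightarrow> complex" where
  "g_sign = (\<lambda>(x, y, z, w). (- 1) powi w)"

definition h_exp :: "nat \<Rightarrow> nat \<Rightarrow> nat \<Rightarrow> int \<times> int \<times> int \<times> int \<Rightarrow> nat" where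
  "h_exp r s t = (\<lambda>(x, y, z, w).
     theta_exp t r x + (theta_exp (2 * t) s y + (theta_exp (2 * t) s z + theta_exp (2 * t) s w)))"

definition h_sign :: "int \<times> int \<times> int \<times> int \<Rightarrow> complex" where
  "h_sign = (\<lambda>(x, y, z, w). (- 1) powi (y + z + w))"

lemma finite_fibre_of_bounded_coordinates:
  fixes e :: "int \<times> int \<times> int \<times> int \<Rightarrow> nat"
  assumes "\<And>x y z w. nat \<bar>x\<bar> \<le> e (x, y, z, w) \<and> nat \<bar>y\<bar> \<le> e (x, y, z, w) \<and>
                     nat \<bar>z\<bar> \<le> e (x, y, z, w) \<and> nat \<bar>w\<bar> \<le> e (x, y, z, w)"
  shows "finite {v. e v = n}"
proof -
  let ?I = "{- int n..int n}"
  have "{v. e v = n} \<subseteq> ?I \<times> ?I \<times> ?I \<times> ?I"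
  proof
    fix v assume v: "v \<in> {v. e v = n}"
    obtain x y z w where xyzw: "v = (x, y, z, w)" by (cases v)
    have "nat \<bar>x\<bar> \<le> n \<and> nat \<bar>y\<bar> \<le> n \<and> nat \<bar>z\<bar> \<le> n \<and> nat \<bar>w\<bar> \<le> n"
      using assms[of x y z w] v xyzw by simp
    then show "v \<in> ?I \<times> ?I \<times> ?I \<times> ?I"
      unfolding xyzw by auto
  qed
  then show ?thesis
    by (rule finite_subset) auto
qed

lemma finite_g_fibre:
  assumes "0 < r" "r < t" "0 < s" "s < 2 * t"
  shows "finite {v. g_exp r s t v = n}"
proof (rule finite_fibre_of_bounded_coordinates)
  fix x y z w
  show "nat \<bar>x\<bar> \<le> g_exp r s t (x, y, z, w) \<and> nat \<bar>y\<bar> \<le> g_exp r s t (x, y, z, w) \<and>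
        nat \<bar>z\<bar> \<le> g_exp r s t (x, y, z, w) \<and> nat \<bar>w\<bar> \<le> g_exp r s t (x, y, z, w)"
    using nat_abs_le_theta_exp[OF assms(1,2)] nat_abs_le_theta_exp[OF assms(3,4)]
    by (simp add: g_exp_def trans_le_add1 trans_le_add2)
qed

lemma finite_h_fibre:
  assumes "0 < r" "r < t" "0 < s" "s < 2 * t"
  shows "finite {v. h_exp r s t v = n}"
proof (rule finite_fibre_of_bounded_coordinates)
  fix x y z w
  show "nat \<bar>x\<bar> \<le> h_exp r s t (x, y, z, w) \<and> nat \<bar>y\<bar> \<le> h_exp r s t (x, y, z, w) \<and>
        nat \<bar>z\<bar> \<le> h_exp r s t (x, y, z, w) \<and> nat \<bar>w\<bar> \<le> h_exp r s t (x, y, z, w)"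
    using nat_abs_le_theta_exp[OF assms(1,2)] nat_abs_le_theta_exp[OF assms(3,4)]
    by (simp add: h_exp_def trans_le_add1 trans_le_add2)
qed

lemma g_lattice_has_sum:
  assumes rs: "0 < r" "r < t" "0 < s" "s < 2 * t" and q: "norm q < 1"
  shows "((\<lambda>v. g_sign v * q ^ g_exp r s t v) has_sum
    g_prod r s t q * (qpoch (q ^ t) (q ^ t) ^ 3 * qpoch (q ^ (2 * t)) (q ^ (2 * t)) ^ 1)) UNIV"
proof -
  define A where "A = qpoch (- (q ^ r)) (q ^ t) * qpoch (- (q ^ (t - r))) (q ^ t)"
  define B where "B = qpoch (q ^ s) (q ^ (2 * t)) * qpoch (q ^ (2 * t - s)) (q ^ (2 * t))"
  define K where "K = qpoch (q ^ t) (q ^ t)"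
  define L where "L = qpoch (q ^ (2 * t)) (q ^ (2 * t))"
  note \<theta> = theta_has_sum[OF rs(1,2) q, folded A_def K_def]
  note \<theta>' = alternating_theta_has_sum[OF rs(3,4) q, folded B_def L_def]
  have "((\<lambda>v. g_sign v * q ^ g_exp r s t v) has_sum A * K * (A * K * (A * K * (B * L)))) UNIV"
    using has_sum_times_product[OF \<theta> has_sum_times_product[OF \<theta> has_sum_times_product[OF \<theta> \<theta>']]]
    by (simp add: g_sign_def g_exp_def power_add case_prod_unfold mult_ac)
  moreover have "A * K * (A * K * (A * K * (B * L))) = A ^ 3 * B * (K ^ 3 * L ^ 1)"
    by (simp add: power3_eq_cube mult_ac)
  ultimately show ?thesis
    by (simp only: g_prod_def A_def B_def K_def L_def)
qed

lemma h_lattice_has_sum: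
  assumes rs: "0 < r" "r < t" "0 < s" "s < 2 * t" and q: "norm q < 1"
  shows "((\<lambda>v. h_sign v * q ^ h_exp r s t v) has_sum
    h_prod r s t q * (qpoch (q ^ t) (q ^ t) ^ 1 * qpoch (q ^ (2 * t)) (q ^ (2 * t)) ^ 3)) UNIV"
proof -
  define A where "A = qpoch (- (q ^ r)) (q ^ t) * qpoch (- (q ^ (t - r))) (q ^ t)"
  define B where "B = qpoch (q ^ s) (q ^ (2 * t)) * qpoch (q ^ (2 * t - s)) (q ^ (2 * t))"
  define K where "K = qpoch (q ^ t) (q ^ t)"
  define L where "L = qpoch (q ^ (2 * t)) (q ^ (2 * t))"
  note \<theta> = theta_has_sum[OF rs(1,2) q, folded A_def K_def]
  note \<theta>' = alternating_theta_has_sum[OF rs(3,4) q, folded B_def L_def]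
  have "((\<lambda>v. h_sign v * q ^ h_exp r s t v) has_sum A * K * (B * L * (B * L * (B * L)))) UNIV"
    using has_sum_times_product[OF \<theta> has_sum_times_product[OF \<theta>' has_sum_times_product[OF \<theta>' \<theta>']]]
    by (simp add: h_sign_def h_exp_def power_add power_int_add case_prod_unfold mult_ac)
  moreover have "A * K * (B * L * (B * L * (B * L))) = A * B ^ 3 * (K ^ 1 * L ^ 3)"
    by (simp add: power3_eq_cube mult_ac)
  ultimately show ?thesis
    by (simp only: h_prod_def A_def B_def K_def L_def)
qed

lemma g_coeff_eqI:
  assumes rs: "0 < r" "r < t" "0 < s" "s < 2 * t" and rs': "0 < r'" "r' < t" "0 < s'" "s' < 2 * t"
    and k: "k < t" "k' < t"
    and eq: "\<And>n. (\<Sum>v | g_exp r s t v = t * n + k. g_sign v) =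
      \<epsilon> * (\<Sum>v | g_exp r' s' t v = t * n + k'. g_sign v)"
  shows "g_coeff r s t (t * n + k) = \<epsilon> * g_coeff r' s' t (t * n + k')"
  using rs rs'
  by (intro coeff_eq_of_lattice_sum_eq[OF g_coeff_power_series g_coeff_power_series
        g_lattice_has_sum[OF rs] g_lattice_has_sum[OF rs'] finite_g_fibre[OF rs] finite_g_fibre[OF rs'] eq k])
    auto

lemma h_coeff_eqI:
  assumes rs: "0 < r" "r < t" "0 < s" "s < 2 * t" and rs': "0 < r'" "r' < t" "0 < s'" "s' < 2 * t"
    and k: "k < t" "k' < t"
    and eq: "\<And>n. (\<Sum>v | h_exp r s t v = t * n + k. h_sign v) =
      \<epsilon> * (\<Sum>v | h_exp r' s' t v = t * n + k'. h_sign v)"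
  shows "h_coeff r s t (t * n + k) = \<epsilon> * h_coeff r' s' t (t * n + k')"
  using rs rs'
  by (intro coeff_eq_of_lattice_sum_eq[OF h_coeff_power_series h_coeff_power_series
        h_lattice_has_sum[OF rs] h_lattice_has_sum[OF rs'] finite_h_fibre[OF rs] finite_h_fibre[OF rs'] eq k])
    auto

section \<open>Reflections between the fibres\<close>

text \<open>
  The maps between the fibres are affine with rational coefficients and integral only where the linear
  form \<open>S\<close> is divisible by \<open>m\<close>. To avoid fractions they are given as families of
  integral maps indexed by the quotient \<open>d = S v / m\<close>; the linear form \<open>S'\<close>
  recovers this quotient from the image. It is enough to ask that the exponents change by the right
  amount, as then the inverse maps the second fibre into the first.
\<close>

lemma sum_fibres_transfer:
  fixes S S' :: "'a \<Rightarrow> int" and \<Phi> \<Psi> :: "int \<Rightarrow> 'a \<Rightarrow> 'a" and e e' :: "'a \<Rightarrow> nat"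
    and c c' :: "'a \<Rightarrow> complex"
  assumes S: "\<And>v. e v = n \<Longrightarrow> m dvd S v"
    and S': "\<And>v. e' v = n' \<Longrightarrow> m dvd S' v"
    and \<Phi>: "\<And>d v. S v = m * d \<Longrightarrow> S' (\<Phi> d v) = m * d \<and> \<Psi> d (\<Phi> d v) = v"
    and \<Psi>: "\<And>d v. S' v = m * d \<Longrightarrow> S (\<Psi> d v) = m * d \<and> \<Phi> d (\<Psi> d v) = v"
    and e: "\<And>d v. S v = m * d \<Longrightarrow> 2 * int (e' (\<Phi> d v)) - 2 * int (e v) = 2 * (int n' - int n)"
    and c: "\<And>d v. S v = m * d \<Longrightarrow> c v = \<epsilon> * c' (\<Phi> d v)"
    and m: "m \<noteq> 0"
  shows "(\<Sum>v | e v = n. c v) = \<epsilon> * (\<Sum>v | e' v = n'. c' v)"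
  unfolding sum_distrib_left
proof (rule sum.reindex_bij_witness[of _ "\<lambda>v. \<Psi> (S' v div m) v" "\<lambda>v. \<Phi> (S v div m) v"])
  fix v assume "v \<in> {v. e v = n}"
  then have v: "e v = n" by simp
  then obtain d where d: "S v = m * d" using S by blast
  then have div: "S v div m = d" "S' (\<Phi> d v) div m = d"
    using m \<Phi> by simp_all
  show "\<Psi> (S' (\<Phi> (S v div m) v) div m) (\<Phi> (S v div m) v) = v"
    unfolding div using \<Phi>[OF d] by simp
  show "\<Phi> (S v div m) v \<in> {v. e' v = n'}"
    unfolding div using e[OF d] v by simp
  show "\<epsilon> * c' (\<Phi> (S v div m) v) = c v"
    unfolding div by (rule c[OF d, symmetric])
next
  fix v assume "v \<in> {v. e' v = n'}"
  then have v: "e' v = n'" by simp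
  then obtain d where d: "S' v = m * d" using S' by blast
  then have div: "S' v div m = d" "S (\<Psi> d v) div m = d"
    using m \<Psi> by simp_all
  show "\<Phi> (S (\<Psi> (S' v div m) v) div m) (\<Psi> (S' v div m) v) = v"
    unfolding div using \<Psi>[OF d] by simp
  show "\<Psi> (S' v div m) v \<in> {v. e v = n}"
    unfolding div using \<Psi>[OF d] e[of "\<Psi> d v" d] v by simp
qed

lemma two_g_exp:
  assumes "r \<le> t" "s \<le> 2 * t"
  shows "2 * int (g_exp r s t (x, y, z, w)) =
    int t * (x * x + y * y + z * z + 2 * (w * w)) + (2 * int r - int t) * (x + y + z) + 2 * (int s - int t) * w"
  using two_theta_exp[OF assms(1), of x] two_theta_exp[OF assms(1), of y]
    two_theta_exp[OF assms(1), of z] two_theta_exp[OF assms(2), of w]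
  by (simp add: g_exp_def algebra_simps)

lemma two_h_exp:
  assumes "r \<le> t" "s \<le> 2 * t"
  shows "2 * int (h_exp r s t (x, y, z, w)) =
    int t * (x * x + 2 * (y * y + z * z + w * w)) + (2 * int r - int t) * x + 2 * (int s - int t) * (y + z + w)"
  using two_theta_exp[OF assms(1), of x] two_theta_exp[OF assms(2), of y]
    two_theta_exp[OF assms(2), of z] two_theta_exp[OF assms(2), of w]
  by (simp add: h_exp_def algebra_simps)

text \<open>
  Modulo 5 the quadratic part of twice the exponent vanishes, so the exponent determines the residue of a
  linear form. It is the source of all divisibility by 5 below: for the pairs \<open>(r, s)\<close> that
  occur, the forms \<open>S\<close> and \<open>S'\<close> are multiples of it modulo 5.
\<close>

lemma g_exp_dvd:
  assumes "r \<le> 5" "s \<le> 10" "g_exp r s 5 (x, y, z, w) = n"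
  shows "5 dvd int r * (x + y + z) + int s * w - int n"
proof -
  have "2 * (int r * (x + y + z) + int s * w - int n) =
      5 * (x + y + z + 2 * w - (x * x + y * y + z * z + 2 * (w * w)))"
    using two_g_exp[of r 5 s x y z w] assms by (simp add: algebra_simps)
  then show ?thesis by presburger
qed

lemma h_exp_dvd:
  assumes "r \<le> 5" "s \<le> 10" "h_exp r s 5 (x, y, z, w) = n"
  shows "5 dvd int r * x + int s * (y + z + w) - int n"
proof -
  have "2 * (int r * x + int s * (y + z + w) - int n) =
      5 * (x + 2 * (y + z + w) - (x * x + 2 * (y * y + z * z + w * w)))"
    using two_h_exp[of r 5 s x y z w] assms by (simp add: algebra_simps)
  then show ?thesis by presburger
qed

text \<open>
  In each of the following lemmas \<open>S\<close> is one tenth of the inner product, with respect to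
  \<open>Q\<close>, of \<open>(X, Y, Z, W)\<close> with \<open>u\<close> (one twentieth in the case of
  \<open>h\<close>), up to a constant which makes it divisible by 5 on the first fibre. The form
  \<open>S'\<close> is \<open>S\<close> expressed in the coordinates of the image. The vector is
  \<open>u = (1, 1, 1, 1)\<close>, and \<open>\<Phi>\<close> is the reflection in \<open>u\<close>.
\<close>

lemma g_lattice_sum_12_24_1:
  "(\<Sum>v | g_exp 1 2 5 v = 5 * n + 1. g_sign v) =
   1 * (\<Sum>v | g_exp 2 4 5 v = 5 * n + 2. g_sign v)"
proof (rule sum_fibres_transfer[where m = 5
      and S = "\<lambda>(x, y, z, w). x + y + z + 2 * w - 1"
      and S' = "\<lambda>(x, y, z, w). 1 - x - y - z - 2 * w"
      and \<Phi> = "\<lambda>d (x, y, z, w). (x - 2 * d, y - 2 * d, z - 2 * d, w - 2 * d)"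
      and \<Psi> = "\<lambda>d (x, y, z, w). (x + 2 * d, y + 2 * d, z + 2 * d, w + 2 * d)"])
  fix v :: "int \<times> int \<times> int \<times> int"
  obtain x y z w where v: "v = (x, y, z, w)" by (cases v)
  show "5 dvd (case v of (x, y, z, w) \<Rightarrow> x + y + z + 2 * w - 1)"
    if E: "g_exp 1 2 5 v = 5 * n + 1"
  proof -
    obtain k where "int 1 * (x + y + z) + int 2 * w - int (5 * n + 1) = 5 * k"
      using g_exp_dvd[OF _ _ E[unfolded v]] by (auto elim: dvdE)
    then have "x + y + z + 2 * w - 1 = 5 * (k + int n)" by simp
    then show ?thesis unfolding v prod.case by (rule dvdI)
  qed
  show "5 dvd (case v of (x, y, z, w) \<Rightarrow> 1 - x - y - z - 2 * w)"
    if E: "g_exp 2 4 5 v = 5 * n + 2"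
  proof -
    obtain k where "int 2 * (x + y + z) + int 4 * w - int (5 * n + 2) = 5 * k"
      using g_exp_dvd[OF _ _ E[unfolded v]] by (auto elim: dvdE)
    then have "1 - x - y - z - 2 * w = 5 * (2 * k + 2 * int n + 1 - x - y - z - 2 * w)" by simp
    then show ?thesis unfolding v prod.case by (rule dvdI)
  qed
  fix d assume S: "(case v of (x, y, z, w) \<Rightarrow> x + y + z + 2 * w - 1) = 5 * d"
  \<comment> \<open>Eliminating \<open>y\<close> turns the comparison of exponents into a polynomial identity.\<close>
  then have y: "y = 5 * d - x - z - 2 * w + 1"
    unfolding v by simp
  show "2 * int (g_exp 2 4 5
      (case v of (x, y, z, w) \<Rightarrow> (x - 2 * d, y - 2 * d, z - 2 * d, w - 2 * d))) -
      2 * int (g_exp 1 2 5 v) =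
      2 * (int (5 * n + 2) - int (5 * n + 1))"
    unfolding v y by (simp add: two_g_exp algebra_simps)
qed (auto simp: g_sign_def power_int_minus_left)

text \<open>
  Here \<open>\<Phi>\<close> is minus the reflection in \<open>u = (1, 1, 1, 1)\<close>, which changes the
  parity of \<open>w\<close>.
\<close>

lemma g_lattice_sum_12_24_3:
  "(\<Sum>v | g_exp 1 2 5 v = 5 * n + 3. g_sign v) =
   - 1 * (\<Sum>v | g_exp 2 4 5 v = 5 * n + 4. g_sign v)"
proof (rule sum_fibres_transfer[where m = 5
      and S = "\<lambda>(x, y, z, w). x + y + z + 2 * w - 3"
      and S' = "\<lambda>(x, y, z, w). x + y + z + 2 * w - 2"
      and \<Phi> = "\<lambda>d (x, y, z, w). (2 * d + 1 - x, 2 * d + 1 - y, 2 * d + 1 - z, 2 * d + 1 - w)"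
      and \<Psi> = "\<lambda>d (x, y, z, w). (2 * d + 1 - x, 2 * d + 1 - y, 2 * d + 1 - z, 2 * d + 1 - w)"])
  fix v :: "int \<times> int \<times> int \<times> int"
  obtain x y z w where v: "v = (x, y, z, w)" by (cases v)
  show "5 dvd (case v of (x, y, z, w) \<Rightarrow> x + y + z + 2 * w - 3)"
    if E: "g_exp 1 2 5 v = 5 * n + 3"
  proof -
    obtain k where "int 1 * (x + y + z) + int 2 * w - int (5 * n + 3) = 5 * k"
      using g_exp_dvd[OF _ _ E[unfolded v]] by (auto elim: dvdE)
    then have "x + y + z + 2 * w - 3 = 5 * (k + int n)" by simp
    then show ?thesis unfolding v prod.case by (rule dvdI)
  qed
  show "5 dvd (case v of (x, y, z, w) \<Rightarrow> x + y + z + 2 * w - 2)"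
    if E: "g_exp 2 4 5 v = 5 * n + 4"
  proof -
    obtain k where "int 2 * (x + y + z) + int 4 * w - int (5 * n + 4) = 5 * k"
      using g_exp_dvd[OF _ _ E[unfolded v]] by (auto elim: dvdE)
    then have "x + y + z + 2 * w - 2 = 5 * (x + y + z + 2 * w - 2 * int n - 2 - 2 * k)" by simp
    then show ?thesis unfolding v prod.case by (rule dvdI)
  qed
  fix d assume S: "(case v of (x, y, z, w) \<Rightarrow> x + y + z + 2 * w - 3) = 5 * d"
  then have y: "y = 5 * d - x - z - 2 * w + 3"
    unfolding v by simp
  show "2 * int (g_exp 2 4 5
      (case v of (x, y, z, w) \<Rightarrow> (2 * d + 1 - x, 2 * d + 1 - y, 2 * d + 1 - z, 2 * d + 1 - w))) -
      2 * int (g_exp 1 2 5 v) =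
      2 * (int (5 * n + 4) - int (5 * n + 3))"
    unfolding v y by (simp add: two_g_exp algebra_simps)
qed (auto simp: g_sign_def power_int_minus_left)

text \<open>
  Here \<open>\<Phi>\<close> is the reflection in \<open>u = (1, 1, 1, -1)\<close>.
\<close>

lemma g_lattice_sum_13_21_0:
  "(\<Sum>v | g_exp 1 3 5 v = 5 * n. g_sign v) =
   1 * (\<Sum>v | g_exp 2 1 5 v = 5 * n. g_sign v)"
proof (rule sum_fibres_transfer[where m = 5
      and S = "\<lambda>(x, y, z, w). x + y + z - 2 * w"
      and S' = "\<lambda>(x, y, z, w). 2 * w - x - y - z"
      and \<Phi> = "\<lambda>d (x, y, z, w). (x - 2 * d, y - 2 * d, z - 2 * d, w + 2 * d)"
      and \<Psi> = "\<lambda>d (x, y, z, w). (x + 2 * d, y + 2 * d, z + 2 * d, w - 2 * d)"])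
  fix v :: "int \<times> int \<times> int \<times> int"
  obtain x y z w where v: "v = (x, y, z, w)" by (cases v)
  show "5 dvd (case v of (x, y, z, w) \<Rightarrow> x + y + z - 2 * w)"
    if E: "g_exp 1 3 5 v = 5 * n"
  proof -
    obtain k where "int 1 * (x + y + z) + int 3 * w - int (5 * n) = 5 * k"
      using g_exp_dvd[OF _ _ E[unfolded v]] by (auto elim: dvdE)
    then have "x + y + z - 2 * w = 5 * (k + int n - w)" by simp
    then show ?thesis unfolding v prod.case by (rule dvdI)
  qed
  show "5 dvd (case v of (x, y, z, w) \<Rightarrow> 2 * w - x - y - z)"
    if E: "g_exp 2 1 5 v = 5 * n"
  proof -
    obtain k where "int 2 * (x + y + z) + int 1 * w - int (5 * n) = 5 * k"
      using g_exp_dvd[OF _ _ E[unfolded v]] by (auto elim: dvdE)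
    then have "2 * w - x - y - z = 5 * (2 * k + 2 * int n - x - y - z)" by simp
    then show ?thesis unfolding v prod.case by (rule dvdI)
  qed
  fix d assume S: "(case v of (x, y, z, w) \<Rightarrow> x + y + z - 2 * w) = 5 * d"
  then have y: "y = 5 * d - x - z + 2 * w"
    unfolding v by simp
  show "2 * int (g_exp 2 1 5
      (case v of (x, y, z, w) \<Rightarrow> (x - 2 * d, y - 2 * d, z - 2 * d, w + 2 * d))) -
      2 * int (g_exp 1 3 5 v) =
      2 * (int (5 * n) - int (5 * n))"
    unfolding v y by (simp add: two_g_exp algebra_simps)
qed (auto simp: g_sign_def power_int_minus_left)

text \<open>
  Here \<open>\<Phi>\<close> is minus the reflection in \<open>u = (1, 1, 1, -1)\<close>.
\<close>

lemma g_lattice_sum_13_21_2: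
  "(\<Sum>v | g_exp 1 3 5 v = 5 * n + 2. g_sign v) =
   1 * (\<Sum>v | g_exp 2 1 5 v = 5 * n + 2. g_sign v)"
proof (rule sum_fibres_transfer[where m = 5
      and S = "\<lambda>(x, y, z, w). x + y + z - 2 * w - 2"
      and S' = "\<lambda>(x, y, z, w). x + y + z - 2 * w - 1"
      and \<Phi> = "\<lambda>d (x, y, z, w). (2 * d + 1 - x, 2 * d + 1 - y, 2 * d + 1 - z, - w - 2 * d)"
      and \<Psi> = "\<lambda>d (x, y, z, w). (2 * d + 1 - x, 2 * d + 1 - y, 2 * d + 1 - z, - w - 2 * d)"])
  fix v :: "int \<times> int \<times> int \<times> int"
  obtain x y z w where v: "v = (x, y, z, w)" by (cases v)
  show "5 dvd (case v of (x, y, z, w) \<Rightarrow> x + y + z - 2 * w - 2)"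
    if E: "g_exp 1 3 5 v = 5 * n + 2"
  proof -
    obtain k where "int 1 * (x + y + z) + int 3 * w - int (5 * n + 2) = 5 * k"
      using g_exp_dvd[OF _ _ E[unfolded v]] by (auto elim: dvdE)
    then have "x + y + z - 2 * w - 2 = 5 * (k + int n - w)" by simp
    then show ?thesis unfolding v prod.case by (rule dvdI)
  qed
  show "5 dvd (case v of (x, y, z, w) \<Rightarrow> x + y + z - 2 * w - 1)"
    if E: "g_exp 2 1 5 v = 5 * n + 2"
  proof -
    obtain k where "int 2 * (x + y + z) + int 1 * w - int (5 * n + 2) = 5 * k"
      using g_exp_dvd[OF _ _ E[unfolded v]] by (auto elim: dvdE)
    then have "x + y + z - 2 * w - 1 = 5 * (x + y + z - 2 * int n - 1 - 2 * k)" by simp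
    then show ?thesis unfolding v prod.case by (rule dvdI)
  qed
  fix d assume S: "(case v of (x, y, z, w) \<Rightarrow> x + y + z - 2 * w - 2) = 5 * d"
  then have y: "y = 5 * d - x - z + 2 * w + 2"
    unfolding v by simp
  show "2 * int (g_exp 2 1 5
      (case v of (x, y, z, w) \<Rightarrow> (2 * d + 1 - x, 2 * d + 1 - y, 2 * d + 1 - z, - w - 2 * d))) -
      2 * int (g_exp 1 3 5 v) =
      2 * (int (5 * n + 2) - int (5 * n + 2))"
    unfolding v y by (simp add: two_g_exp algebra_simps)
qed (auto simp: g_sign_def power_int_minus_left)

text \<open>
  Here \<open>\<Phi>\<close> is the reflection in \<open>u = (2, 1, 1, 1)\<close>, followed by negation of
  the last three coordinates.
\<close>

lemma h_lattice_sum_11_23_0: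
  "(\<Sum>v | h_exp 1 1 5 v = 5 * n. h_sign v) =
   1 * (\<Sum>v | h_exp 2 3 5 v = 5 * n + 2. h_sign v)"
proof (rule sum_fibres_transfer[where m = 5
      and S = "\<lambda>(x, y, z, w). x + y + z + w"
      and S' = "\<lambda>(x, y, z, w). y + z + w + 1 - x"
      and \<Phi> = "\<lambda>d (x, y, z, w). (x + 1 - 4 * d, 2 * d - y, 2 * d - z, 2 * d - w)"
      and \<Psi> = "\<lambda>d (x, y, z, w). (x - 1 + 4 * d, 2 * d - y, 2 * d - z, 2 * d - w)"])
  fix v :: "int \<times> int \<times> int \<times> int"
  obtain x y z w where v: "v = (x, y, z, w)" by (cases v)
  show "5 dvd (case v of (x, y, z, w) \<Rightarrow> x + y + z + w)"
    if E: "h_exp 1 1 5 v = 5 * n"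
  proof -
    obtain k where "int 1 * x + int 1 * (y + z + w) - int (5 * n) = 5 * k"
      using h_exp_dvd[OF _ _ E[unfolded v]] by (auto elim: dvdE)
    then have "x + y + z + w = 5 * (k + int n)" by simp
    then show ?thesis unfolding v prod.case by (rule dvdI)
  qed
  show "5 dvd (case v of (x, y, z, w) \<Rightarrow> y + z + w + 1 - x)"
    if E: "h_exp 2 3 5 v = 5 * n + 2"
  proof -
    obtain k where "int 2 * x + int 3 * (y + z + w) - int (5 * n + 2) = 5 * k"
      using h_exp_dvd[OF _ _ E[unfolded v]] by (auto elim: dvdE)
    then have "y + z + w + 1 - x = 5 * (2 * k + 2 * int n + 1 - x - y - z - w)" by simp
    then show ?thesis unfolding v prod.case by (rule dvdI)
  qed
  fix d assume S: "(case v of (x, y, z, w) \<Rightarrow> x + y + z + w) = 5 * d"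
  then have y: "y = 5 * d - x - z - w"
    unfolding v by simp
  show "2 * int (h_exp 2 3 5
      (case v of (x, y, z, w) \<Rightarrow> (x + 1 - 4 * d, 2 * d - y, 2 * d - z, 2 * d - w))) -
      2 * int (h_exp 1 1 5 v) =
      2 * (int (5 * n + 2) - int (5 * n))"
    unfolding v y by (simp add: two_h_exp algebra_simps)
qed (auto simp: h_sign_def power_int_minus_left)

text \<open>
  Here \<open>\<Phi>\<close> is the reflection in \<open>u = (2, 1, 1, 1)\<close>, followed by negation of
  the first coordinate.
\<close>

lemma h_lattice_sum_11_23_1:
  "(\<Sum>v | h_exp 1 1 5 v = 5 * n + 1. h_sign v) =
   1 * (\<Sum>v | h_exp 2 3 5 v = 5 * n + 3. h_sign v)"
proof (rule sum_fibres_transfer[where m = 5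
      and S = "\<lambda>(x, y, z, w). x + y + z + w - 1"
      and S' = "\<lambda>(x, y, z, w). x + 1 - y - z - w"
      and \<Phi> = "\<lambda>d (x, y, z, w). (4 * d - x, y - 2 * d, z - 2 * d, w - 2 * d)"
      and \<Psi> = "\<lambda>d (x, y, z, w). (4 * d - x, y + 2 * d, z + 2 * d, w + 2 * d)"])
  fix v :: "int \<times> int \<times> int \<times> int"
  obtain x y z w where v: "v = (x, y, z, w)" by (cases v)
  show "5 dvd (case v of (x, y, z, w) \<Rightarrow> x + y + z + w - 1)"
    if E: "h_exp 1 1 5 v = 5 * n + 1"
  proof -
    obtain k where "int 1 * x + int 1 * (y + z + w) - int (5 * n + 1) = 5 * k"
      using h_exp_dvd[OF _ _ E[unfolded v]] by (auto elim: dvdE)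
    then have "x + y + z + w - 1 = 5 * (k + int n)" by simp
    then show ?thesis unfolding v prod.case by (rule dvdI)
  qed
  show "5 dvd (case v of (x, y, z, w) \<Rightarrow> x + 1 - y - z - w)"
    if E: "h_exp 2 3 5 v = 5 * n + 3"
  proof -
    obtain k where "int 2 * x + int 3 * (y + z + w) - int (5 * n + 3) = 5 * k"
      using h_exp_dvd[OF _ _ E[unfolded v]] by (auto elim: dvdE)
    then have "x + 1 - y - z - w = 5 * (x + y + z + w - 2 * int n - 1 - 2 * k)" by simp
    then show ?thesis unfolding v prod.case by (rule dvdI)
  qed
  fix d assume S: "(case v of (x, y, z, w) \<Rightarrow> x + y + z + w - 1) = 5 * d"
  then have y: "y = 5 * d - x - z - w + 1"
    unfolding v by simp
  show "2 * int (h_exp 2 3 5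
      (case v of (x, y, z, w) \<Rightarrow> (4 * d - x, y - 2 * d, z - 2 * d, w - 2 * d))) -
      2 * int (h_exp 1 1 5 v) =
      2 * (int (5 * n + 3) - int (5 * n + 1))"
    unfolding v y by (simp add: two_h_exp algebra_simps)
qed (auto simp: h_sign_def power_int_minus_left)

text \<open>
  Here \<open>\<Phi>\<close> is the reflection in \<open>u = (-2, 1, 1, 1)\<close>, followed by negation
  of the last three coordinates.
\<close>

lemma h_lattice_sum_14_22_1:
  "(\<Sum>v | h_exp 1 4 5 v = 5 * n + 1. h_sign v) =
   1 * (\<Sum>v | h_exp 2 2 5 v = 5 * n. h_sign v)"
proof (rule sum_fibres_transfer[where m = 5
      and S = "\<lambda>(x, y, z, w). y + z + w - x + 1"
      and S' = "\<lambda>(x, y, z, w). x + y + z + w"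
      and \<Phi> = "\<lambda>d (x, y, z, w). (x - 1 + 4 * d, 2 * d - y, 2 * d - z, 2 * d - w)"
      and \<Psi> = "\<lambda>d (x, y, z, w). (x + 1 - 4 * d, 2 * d - y, 2 * d - z, 2 * d - w)"])
  fix v :: "int \<times> int \<times> int \<times> int"
  obtain x y z w where v: "v = (x, y, z, w)" by (cases v)
  show "5 dvd (case v of (x, y, z, w) \<Rightarrow> y + z + w - x + 1)"
    if E: "h_exp 1 4 5 v = 5 * n + 1"
  proof -
    obtain k where "int 1 * x + int 4 * (y + z + w) - int (5 * n + 1) = 5 * k"
      using h_exp_dvd[OF _ _ E[unfolded v]] by (auto elim: dvdE)
    then have "y + z + w - x + 1 = 5 * (y + z + w - int n - k)" by simp
    then show ?thesis unfolding v prod.case by (rule dvdI)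
  qed
  show "5 dvd (case v of (x, y, z, w) \<Rightarrow> x + y + z + w)"
    if E: "h_exp 2 2 5 v = 5 * n"
  proof -
    obtain k where "int 2 * x + int 2 * (y + z + w) - int (5 * n) = 5 * k"
      using h_exp_dvd[OF _ _ E[unfolded v]] by (auto elim: dvdE)
    then have "x + y + z + w = 5 * (x + y + z + w - 2 * int n - 2 * k)" by simp
    then show ?thesis unfolding v prod.case by (rule dvdI)
  qed
  fix d assume S: "(case v of (x, y, z, w) \<Rightarrow> y + z + w - x + 1) = 5 * d"
  then have y: "y = 5 * d - z - w + x - 1"
    unfolding v by simp
  show "2 * int (h_exp 2 2 5
      (case v of (x, y, z, w) \<Rightarrow> (x - 1 + 4 * d, 2 * d - y, 2 * d - z, 2 * d - w))) -
      2 * int (h_exp 1 4 5 v) =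
      2 * (int (5 * n) - int (5 * n + 1))"
    unfolding v y by (simp add: two_h_exp algebra_simps)
qed (auto simp: h_sign_def power_int_minus_left)

text \<open>
  Here \<open>\<Phi>\<close> is the reflection in \<open>u = (-2, 1, 1, 1)\<close>, followed by negation
  of the first coordinate. It changes the parity of each of \<open>y\<close>, \<open>z\<close> and
  \<open>w\<close>.
\<close>

lemma h_lattice_sum_14_22_2:
  "(\<Sum>v | h_exp 1 4 5 v = 5 * n + 2. h_sign v) =
   - 1 * (\<Sum>v | h_exp 2 2 5 v = 5 * n + 1. h_sign v)"
proof (rule sum_fibres_transfer[where m = 5
      and S = "\<lambda>(x, y, z, w). y + z + w - x + 2"
      and S' = "\<lambda>(x, y, z, w). 3 - x - y - z - w"
      and \<Phi> = "\<lambda>d (x, y, z, w). (2 - 4 * d - x, y + 1 - 2 * d, z + 1 - 2 * d, w + 1 - 2 * d)"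
      and \<Psi> = "\<lambda>d (x, y, z, w). (2 - 4 * d - x, y - 1 + 2 * d, z - 1 + 2 * d, w - 1 + 2 * d)"])
  fix v :: "int \<times> int \<times> int \<times> int"
  obtain x y z w where v: "v = (x, y, z, w)" by (cases v)
  show "5 dvd (case v of (x, y, z, w) \<Rightarrow> y + z + w - x + 2)"
    if E: "h_exp 1 4 5 v = 5 * n + 2"
  proof -
    obtain k where "int 1 * x + int 4 * (y + z + w) - int (5 * n + 2) = 5 * k"
      using h_exp_dvd[OF _ _ E[unfolded v]] by (auto elim: dvdE)
    then have "y + z + w - x + 2 = 5 * (y + z + w - int n - k)" by simp
    then show ?thesis unfolding v prod.case by (rule dvdI)
  qed
  show "5 dvd (case v of (x, y, z, w) \<Rightarrow> 3 - x - y - z - w)"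
    if E: "h_exp 2 2 5 v = 5 * n + 1"
  proof -
    obtain k where "int 2 * x + int 2 * (y + z + w) - int (5 * n + 1) = 5 * k"
      using h_exp_dvd[OF _ _ E[unfolded v]] by (auto elim: dvdE)
    then have "3 - x - y - z - w = 5 * (2 * k + 2 * int n + 1 - x - y - z - w)" by simp
    then show ?thesis unfolding v prod.case by (rule dvdI)
  qed
  fix d assume S: "(case v of (x, y, z, w) \<Rightarrow> y + z + w - x + 2) = 5 * d"
  then have y: "y = 5 * d - z - w + x - 2"
    unfolding v by simp
  show "2 * int (h_exp 2 2 5
      (case v of (x, y, z, w) \<Rightarrow> (2 - 4 * d - x, y + 1 - 2 * d, z + 1 - 2 * d, w + 1 - 2 * d))) -
      2 * int (h_exp 1 4 5 v) =
      2 * (int (5 * n + 1) - int (5 * n + 2))"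
    unfolding v y by (simp add: two_h_exp algebra_simps)
qed (auto simp: h_sign_def power_int_minus_left)

section \<open>The coefficient identities\<close>

theorem theorem1p6:
  fixes n :: nat
  shows "g_coeff 1 2 5 (5 * n + 1) = g_coeff 2 4 5 (5 * n + 2) \<and>
         g_coeff 1 2 5 (5 * n + 3) = - g_coeff 2 4 5 (5 * n + 4) \<and>
         g_coeff 1 3 5 (5 * n) = g_coeff 2 1 5 (5 * n) \<and>
         g_coeff 1 3 5 (5 * n + 2) = g_coeff 2 1 5 (5 * n + 2) \<and>
         h_coeff 1 1 5 (5 * n) = h_coeff 2 3 5 (5 * n + 2) \<and>
         h_coeff 1 1 5 (5 * n + 1) = h_coeff 2 3 5 (5 * n + 3) \<and>
         h_coeff 1 4 5 (5 * n + 1) = h_coeff 2 2 5 (5 * n) \<and>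
         h_coeff 1 4 5 (5 * n + 2) = - h_coeff 2 2 5 (5 * n + 1)"
proof -
  have "g_coeff 1 2 5 (5 * n + 1) = g_coeff 2 4 5 (5 * n + 2)"
    using g_coeff_eqI[of 1 5 2 2 4 1 2 "1" n] g_lattice_sum_12_24_1 by simp
  moreover have "g_coeff 1 2 5 (5 * n + 3) = - g_coeff 2 4 5 (5 * n + 4)"
    using g_coeff_eqI[of 1 5 2 2 4 3 4 "- 1" n] g_lattice_sum_12_24_3 by simp
  moreover have "g_coeff 1 3 5 (5 * n) = g_coeff 2 1 5 (5 * n)"
    using g_coeff_eqI[of 1 5 3 2 1 0 0 "1" n] g_lattice_sum_13_21_0 by simp
  moreover have "g_coeff 1 3 5 (5 * n + 2) = g_coeff 2 1 5 (5 * n + 2)"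
    using g_coeff_eqI[of 1 5 3 2 1 2 2 "1" n] g_lattice_sum_13_21_2 by simp
  moreover have "h_coeff 1 1 5 (5 * n) = h_coeff 2 3 5 (5 * n + 2)"
    using h_coeff_eqI[of 1 5 1 2 3 0 2 "1" n] h_lattice_sum_11_23_0 by simp
  moreover have "h_coeff 1 1 5 (5 * n + 1) = h_coeff 2 3 5 (5 * n + 3)"
    using h_coeff_eqI[of 1 5 1 2 3 1 3 "1" n] h_lattice_sum_11_23_1 by simp
  moreover have "h_coeff 1 4 5 (5 * n + 1) = h_coeff 2 2 5 (5 * n)"
    using h_coeff_eqI[of 1 5 4 2 2 1 0 "1" n] h_lattice_sum_14_22_1 by simp
  moreover have "h_coeff 1 4 5 (5 * n + 2) = - h_coeff 2 2 5 (5 * n + 1)"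
    using h_coeff_eqI[of 1 5 4 2 2 2 1 "- 1" n] h_lattice_sum_14_22_2 by simp
  ultimately show ?thesis by blast
qed

end
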